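(* Let $m\ge 4$ and let $C=C_1\cup\dots\cup C_m\subset\mathbb{P}^2$ be a normal crossing divisor whose irreducible components $C_j:f_j=0$ are smooth curves of degree $e_j$; let $f=f_1\cdots f_m$ and $d=\deg f=e_1+\dots+e_m$. Assume that exactly two components of $C$ are lines and that $f_1=x$, $f_2=y$ (so $e_j\ge 2$ for $j\ge 3$). Then the minimal graded free resolution of the graded $S$-module $D_0(f)$ has the shape $$0\to\bigoplus_{j=3}^{m}S(-d+2-e_j)\to S(-d+2)^{m-1}\oplus S(-d+1)\ (\to D_0(f)\to 0),$$ and hence the minimal graded free resolution of the Jacobian algebra $M(f)$ has the shape $$0\to\bigoplus_{j=3}^{m}S(-2d+3-e_j)\to S(-2d+3)^{m-1}\oplus S(-2d+2)\to S(-d+1)^3\to S\ (\to M(f)\to 0).$$ Moreover, the $m-2$ generating syzygies $\rho_3,\dots,\rho_m$ of $D_0(f)$ (i.e. the generators of the module of relations among the generators of $D_0(f)$, given by the first map of the first resolution) correspond to the following relations among the 2-forms $\omega_1,\dots,\omega_{m-1},\omega^z$ that generate $D_0(f)$: $$\rho_j:\quad f_j\omega_j-(x f_{j,x}\,\omega_1+y f_{j,y}\,\omega_2+f_{j,z}\,\omega^z)=0,\qquad j=3,\dots,m,$$ where for $j=m$ the form $\omega_m$ has to be replaced by $-\sum_{i=1}^{m-1}\omega_i$.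
   Context: $S=\mathbb{C}[x,y,z]$ with its standard grading, and $\mathbb{P}^2$ is the complex projective plane. For $f\in S$ homogeneous with partial derivatives $f_x,f_y,f_z$, the Jacobian ideal is $J_f=(f_x,f_y,f_z)$, the Jacobian (Milnor) algebra is $M(f)=S/J_f$, and the graded module of Jacobian syzygies is $D_0(f)=\{(a,b,c)\in S^3: af_x+bf_y+cf_z=0\}$; a homogeneous syzygy $(a,b,c)$ has degree equal to the common degree of $a,b,c$. $f_{j,x},f_{j,y},f_{j,z}$ denote the partial derivatives of $f_j$. $\Omega^j$ is the $S$-module of polynomial differential $j$-forms on $\mathbb{C}^3$. A triple $(a,b,c)\in S^3$ is identified with the 2-form $a\,dy\wedge dz-b\,dx\wedge dz+c\,dx\wedge dy$; under this identification $D_0(f)$ corresponds to the 2-forms $\omega$ with $df\wedge\omega=0$. Define $\omega^z=df\wedge dz$, and for $j=1,\dots,m$ $$\omega_j=df\wedge\frac{df_j}{f_j}=\sum_{1\le i\le m,\ i\ne j}\frac{f}{f_if_j}\,df_i\wedge df_j\in\Omega^2 .$$ These satisfy $\sum_{j=1}^m\omega_j=0$. *)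

theory Defs
  imports
    Complex_Main
    "HOL-Computational_Algebra.Polynomial"
    "Jordan_Normal_Form.Matrix_Kernel"
begin

section \<open>The polynomial ring in three variables\<close>

text \<open>
  The ring of complex polynomials in \<open>x, y, z\<close> is rendered as the iterated polynomial
  ring in which \<open>z\<close> is the outermost variable, so the coefficient of the
  monomial \<open>x^i y^j z^k\<close> in \<open>p\<close> is \<open>coeff (coeff (coeff p k) j) i\<close>.
\<close>

type_synonym poly3 = "complex poly poly poly"

definition coeff3 :: "poly3 \<Rightarrow> nat \<Rightarrow> nat \<Rightarrow> nat \<Rightarrow> complex" where
  "coeff3 p i j k = coeff (coeff (coeff p k) j) i"

definition varx :: poly3 where "varx = [:[:[:0, 1:]:]:]"
definition vary :: poly3 where "vary = [:[:0, 1:]:]"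
definition varz :: poly3 where "varz = [:0, 1:]"

definition eval3 :: "poly3 \<Rightarrow> complex \<Rightarrow> complex \<Rightarrow> complex \<Rightarrow> complex" where
  "eval3 p a b c = poly (poly (poly p [:[:c:]:]) [:b:]) a"

definition pdx :: "poly3 \<Rightarrow> poly3" where "pdx p = map_poly (map_poly pderiv) p"
definition pdy :: "poly3 \<Rightarrow> poly3" where "pdy p = map_poly pderiv p"
definition pdz :: "poly3 \<Rightarrow> poly3" where "pdz p = pderiv p"

text \<open>
  The degree is an integer because twists shift degrees; zero is homogeneous of every degree,
  and is the only homogeneous element of negative degree.
\<close>

definition homogeneous :: "int \<Rightarrow> poly3 \<Rightarrow> bool" where
  "homogeneous n p \<longleftrightarrow> (\<forall>i j k. coeff3 p i j k \<noteq> 0 \<longrightarrow> int (i + j + k) = n)"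

text \<open>The irrelevant maximal ideal \<open>(x, y, z)\<close>.\<close>

definition irrelevant_ideal :: "poly3 set" where
  "irrelevant_ideal = {p. coeff3 p 0 0 0 = 0}"


section \<open>Plane curves\<close>

text \<open>Points of the projective plane are represented by their nonzero homogeneous coordinates.\<close>

definition smooth_curve :: "poly3 \<Rightarrow> bool" where
  "smooth_curve g \<longleftrightarrow>
     (\<forall>a b c. (a, b, c) \<noteq> (0, 0, 0) \<and> eval3 g a b c = 0 \<longrightarrow>
        (eval3 (pdx g) a b c, eval3 (pdy g) a b c, eval3 (pdz g) a b c) \<noteq> (0, 0, 0))"

text \<open>
  A divisor with smooth components \<open>g j = 0\<close> (\<open>j \<in> I\<close>) has normal crossings if at
  every point the local equations of the components through that point are part of a
  system of local parameters, that is, have linearly independent differentials there.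
  By Euler's formula the gradient of a homogeneous \<open>g j\<close> at a zero \<open>P\<close> annihilates \<open>P\<close>;
  it is then an element of the cotangent space of the projective plane
  at \<open>P\<close> (the two-dimensional space of linear forms vanishing on \<open>P\<close>, up to a twist). In
  particular, at most two components meet at a point, and they do so transversally.
\<close>

definition normal_crossing :: "'i set \<Rightarrow> ('i \<Rightarrow> poly3) \<Rightarrow> bool" where
  "normal_crossing I g \<longleftrightarrow>
     (\<forall>a b c. (a, b, c) \<noteq> (0, 0, 0) \<longrightarrow>
       (let J = {j \<in> I. eval3 (g j) a b c = 0} in
        \<forall>l. (\<Sum>j\<in>J. l j * eval3 (pdx (g j)) a b c) = 0 \<and>
            (\<Sum>j\<in>J. l j * eval3 (pdy (g j)) a b c) = 0 \<and>
            (\<Sum>j\<in>J. l j * eval3 (pdz (g j)) a b c) = 0 \<longrightarrow>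
            (\<forall>j\<in>J. l j = 0)))"


section \<open>Jacobian syzygies and the Jacobian ideal\<close>

definition jacobian_syzygies :: "poly3 \<Rightarrow> poly3 vec set" where
  "jacobian_syzygies f =
     {v \<in> carrier_vec 3. v $ 0 * pdx f + v $ 1 * pdy f + v $ 2 * pdz f = 0}"

definition jacobian_ideal :: "poly3 \<Rightarrow> poly3 set" where
  "jacobian_ideal f = {a * pdx f + b * pdy f + c * pdz f | a b c. True}"


section \<open>Differential forms\<close>

text \<open>
  The 1-form \<open>p dx + q dy + r dz\<close> is the vector \<open>(p, q, r)\<close>, and the
  2-form \<open>a dy\<and>dz - b dx\<and>dz + c dx\<and>dy\<close> is the vector \<open>(a, b, c)\<close>. Mind the sign of
  the middle term, which makes the wedge product of two 1-forms the cross product.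
\<close>

definition ext_d :: "poly3 \<Rightarrow> poly3 vec" where
  "ext_d f = vec_of_list [pdx f, pdy f, pdz f]"

definition wedge :: "poly3 vec \<Rightarrow> poly3 vec \<Rightarrow> poly3 vec" where
  "wedge u v = vec_of_list
     [u $ 1 * v $ 2 - u $ 2 * v $ 1, u $ 2 * v $ 0 - u $ 0 * v $ 2, u $ 0 * v $ 1 - u $ 1 * v $ 0]"

text \<open>
  For \<open>f\<close> the product of \<open>g 1, ..., g m\<close>, the 2-form \<open>df \<and> d(g j) / g j\<close>, written with
  polynomial coefficients; the division by \<open>g i * g j\<close> is exact.
\<close>

definition omega :: "nat \<Rightarrow> (nat \<Rightarrow> poly3) \<Rightarrow> nat \<Rightarrow> poly3 vec" where
  "omega m g j = vec 3 (\<lambda>r. \<Sum>i\<in>{1..m} - {j}.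
     ((\<Prod>k=1..m. g k) div (g i * g j)) * wedge (ext_d (g i)) (ext_d (g j)) $ r)"

definition omega_z :: "poly3 \<Rightarrow> poly3 vec" where
  "omega_z f = wedge (ext_d f) (ext_d varz)"

text \<open>The last of the forms \<open>omega m g j\<close>, expressed through the other ones.\<close>

definition omega_subst :: "nat \<Rightarrow> (nat \<Rightarrow> poly3) \<Rightarrow> nat \<Rightarrow> poly3 vec" where
  "omega_subst m g j =
     (if j = m then vec 3 (\<lambda>r. - (\<Sum>i=1..m-1. omega m g i $ r)) else omega m g j)"


section \<open>Minimal graded free resolutions\<close>

text \<open>
  A list \<open>a = [a0, ..., ar]\<close> of integers stands for the graded free
  module \<open>S(-a0) \<oplus> ... \<oplus> S(-ar)\<close>, whose \<open>i\<close>-th basis vector has degree \<open>a ! i\<close>. A matrix \<open>A\<close>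
  is a degree-preserving map from the module of \<open>b\<close> to that of \<open>a\<close> iff
  its \<open>(i, j)\<close> entry is homogeneous of degree \<open>b ! j - a ! i\<close>.
\<close>

definition graded_map :: "int list \<Rightarrow> int list \<Rightarrow> poly3 mat \<Rightarrow> bool" where
  "graded_map b a A \<longleftrightarrow> A \<in> carrier_mat (length a) (length b) \<and>
     (\<forall>i<length a. \<forall>j<length b. homogeneous (b ! j - a ! i) (A $$ (i, j)))"

definition mat_image :: "poly3 mat \<Rightarrow> poly3 vec set" where
  "mat_image A = {A *\<^sub>v v | v. v \<in> carrier_vec (dim_col A)}"

text \<open>
  Resolutions of the graded module \<open>N / K\<close>, where \<open>K \<subseteq> N\<close> are graded submodules of the graded
  free module of the list \<open>a\<close>. For \<open>bs = [b0, ..., bn]\<close> and \<open>As = [A1, ..., An]\<close>, the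
  definition says that
    \<open>0 \<rightarrow> F(bn) \<rightarrow> ... \<rightarrow> F(b0) \<rightarrow> N / K \<rightarrow> 0\<close>
  is exact and minimal, where \<open>F(b)\<close> is the graded free module of the list \<open>b\<close>, the
  map from \<open>F(bi)\<close> to \<open>F(b(i-1))\<close> is \<open>Ai\<close>, and the augmentation is induced by \<open>E\<close> (every graded
  map from a free module to \<open>N / K\<close> lifts to such an \<open>E\<close>). Minimality means that each differential
  maps into the irrelevant ideal times its target.
\<close>

definition incoming_image :: "int list list \<Rightarrow> poly3 mat list \<Rightarrow> nat \<Rightarrow> poly3 vec set" where
  "incoming_image bs As i =
     (if i < length As then mat_image (As ! i) else {0\<^sub>v (length (bs ! i))})"

definition minimal_graded_free_resolution ::
  "int list \<Rightarrow> poly3 vec set \<Rightarrow> poly3 vec set \<Rightarrow> int list list \<Rightarrow> poly3 mat \<Rightarrow> poly3 mat list \<Rightarrow> bool"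
where
  "minimal_graded_free_resolution a N K bs E As \<longleftrightarrow>
     length bs = Suc (length As) \<and>
     graded_map (bs ! 0) a E \<and>
     (\<forall>i<length As. graded_map (bs ! Suc i) (bs ! i) (As ! i)) \<and>
     N = {u + k | u k. u \<in> mat_image E \<and> k \<in> K} \<and>
     {v \<in> carrier_vec (length (bs ! 0)). E *\<^sub>v v \<in> K} = incoming_image bs As 0 \<and>
     (\<forall>i<length As. mat_kernel (As ! i) = incoming_image bs As (Suc i)) \<and>
     (\<forall>i<length As. elements_mat (As ! i) \<subseteq> irrelevant_ideal)"

text \<open>
  Minimal graded free resolutions are unique up to isomorphism, so the shape of the resolution
  is described by exhibiting one.
\<close>

definition minimal_resolution_shape ::
  "int list \<Rightarrow> poly3 vec set \<Rightarrow> poly3 vec set \<Rightarrow> int list list \<Rightarrow> bool"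
where
  "minimal_resolution_shape a N K bs \<longleftrightarrow> (\<exists>E As. minimal_graded_free_resolution a N K bs E As)"

definition syzygies_resolution_shape :: "poly3 \<Rightarrow> int list list \<Rightarrow> bool" where
  "syzygies_resolution_shape f bs \<longleftrightarrow>
     minimal_resolution_shape [0, 0, 0] (jacobian_syzygies f) {0\<^sub>v 3} bs"

definition jacobian_algebra_resolution_shape :: "poly3 \<Rightarrow> int list list \<Rightarrow> bool" where
  "jacobian_algebra_resolution_shape f bs \<longleftrightarrow>
     minimal_resolution_shape [0] (carrier_vec 1) {v \<in> carrier_vec 1. v $ 0 \<in> jacobian_ideal f} bs"


section \<open>The generators and their relations\<close>

text \<open>The columns are \<open>\<omega>_1, ..., \<omega>_(m-1), \<omega>^z\<close>.\<close>

definition omega_matrix :: "nat \<Rightarrow> (nat \<Rightarrow> poly3) \<Rightarrow> poly3 mat" where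
  "omega_matrix m g =
     mat_of_cols 3 (map (omega m g) [1..<m] @ [omega_z (\<Prod>k=1..m. g k)])"

text \<open>
  Coordinates of \<open>\<omega>_j\<close> with respect to these generators, where \<open>\<omega>_m\<close>
  stands for \<open>- (\<omega>_1 + ... + \<omega>_(m-1))\<close>, and of \<open>\<omega>^z\<close>.
\<close>

definition omega_coord :: "nat \<Rightarrow> nat \<Rightarrow> poly3 vec" where
  "omega_coord m j =
     (if j = m then vec m (\<lambda>r. if r < m - 1 then - 1 else 0) else unit_vec m (j - 1))"

definition omega_z_coord :: "nat \<Rightarrow> poly3 vec" where
  "omega_z_coord m = unit_vec m (m - 1)"

definition rho :: "nat \<Rightarrow> (nat \<Rightarrow> poly3) \<Rightarrow> nat \<Rightarrow> poly3 vec" where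
  "rho m g j = g j \<cdot>\<^sub>v omega_coord m j -
     ((varx * pdx (g j)) \<cdot>\<^sub>v omega_coord m 1 + (vary * pdy (g j)) \<cdot>\<^sub>v omega_coord m 2 +
      pdz (g j) \<cdot>\<^sub>v omega_z_coord m)"

text \<open>The columns are \<open>\<rho>_3, ..., \<rho>_m\<close>.\<close>

definition rho_matrix :: "nat \<Rightarrow> (nat \<Rightarrow> poly3) \<Rightarrow> poly3 mat" where
  "rho_matrix m g = mat_of_cols m (map (rho m g) [3..<Suc m])"

end

theory Submission
  imports Defs
    "HOL-Computational_Algebra.Polynomial_Factorial"
    "HOL-Computational_Algebra.Field_as_Ring"
    "HOL-Computational_Algebra.Fundamental_Theorem_Algebra"
    "HOL-Analysis.Continuum_Not_Denumerable"
begin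

text \<open>
  Write \<open>A\<close> for the matrix with columns \<open>\<omega>_1, ..., \<omega>_(m-1), \<omega>^z\<close> and \<open>B\<close> for the one with columns
  \<open>\<rho>_3, ..., \<rho>_m\<close>. All claims reduce to the exactness of
  \<open>0 \<rightarrow> S^(m-2) \<rightarrow> S^m \<rightarrow> D_0(F) \<rightarrow> 0\<close>, whose maps are \<open>B\<close> and \<open>A\<close>: the degrees of the entries
  then give the twists, all entries have positive degree (for \<open>B\<close> because no \<open>f_j\<close> with \<open>j \<ge> 3\<close> is
  a line), which is minimality, and splicing in the row of partial derivatives of \<open>F\<close> turns the
  resolution of \<open>D_0(F)\<close> into the one of \<open>M(F)\<close>.
  Throughout, \<open>G_j = F / f_j\<close>, so that \<open>\<omega>_j = dG_j \<and> df_j\<close> and \<open>f_j \<omega>_j = dF \<and> df_j\<close>. As the first two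
  components are the lines \<open>x\<close> and \<open>y\<close>, this gives \<open>x \<omega>_1 = dF \<and> dx\<close> and \<open>y \<omega>_2 = dF \<and> dy\<close>, and
  \<open>\<rho>_j\<close> just expands \<open>dF \<and> df_j\<close> in \<open>dF \<and> dx\<close>, \<open>dF \<and> dy\<close> and \<open>dF \<and> dz\<close>.

  Exactness at the two free modules rests on Euler's formula and unique factorization
  (\<open>kernel_B\<close>, \<open>kernel_A\<close>). A relation \<open>\<Sum> V_i \<omega>_i + V_z \<omega>^z = 0\<close> says that the 1-form
  \<open>\<Sum> V_i G_i df_i + F V_z dz\<close> is proportional to \<open>dF = \<Sum> G_i df_i\<close>. Contraction with the Euler vector field
  shows that the factor is a polynomial \<open>g\<close>, so
  \<open>\<Sum> (V_i - g) G_i df_i + F V_z dz = 0\<close>. Modulo the prime \<open>f_j\<close> only the \<open>j\<close>-th term survives,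
  whence \<open>V_j - g = f_j Q_j\<close>. Dividing by \<open>F\<close> leaves \<open>\<Sum> Q_j df_j + V_z dz = 0\<close>; its
  components determine \<open>Q_1\<close>, \<open>Q_2\<close> and \<open>V_z\<close> by \<open>Q_3, ..., Q_m\<close>, and this is the assertion that the
  relation is \<open>\<Sum> Q_j \<rho>_j\<close>.

  Generation (\<open>image_A\<close>) first holds up to multiplication by certain polynomials. Let \<open>\<theta> \<in> D_0(F)\<close>, regarded as
  a vector. From \<open>dF \<cdot> \<theta> = 0\<close> it follows that \<open>F_t \<theta>\<close> is of the form \<open>dF \<and> u\<close> for each partial
  derivative \<open>F_t\<close> and hence in the image of \<open>A\<close> (\<open>partial_annihilates\<close>). Moreover \<open>\<theta>\<close> is logarithmic
  along each component: \<open>df_j \<cdot> \<theta> = f_j h_j\<close> and \<open>dG_j \<cdot> \<theta> = - G_j h_j\<close>. Therefore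
  \<open>\<theta> \<times> \<omega>_j = h_j dF\<close>, and multiplying vectorially by a coordinate vector shows that each
  coordinate of \<open>\<omega>_j\<close> multiplies \<open>\<theta>\<close> into the image of \<open>A\<close> (\<open>omega_annihilates\<close>).

  Normal crossings enter here: these multipliers have no common zero except the origin
  (\<open>no_common_zero\<close>). If all partial derivatives of \<open>F\<close> vanish at another point, then
  that point is a node where precisely two components meet, and there \<open>\<omega>_i\<close> is a nonzero multiple of \<open>df_j \<and> df_i\<close>, which does not vanish by
  transversality. By the Nullstellensatz \<open>x^N \<theta>\<close>, \<open>y^N \<theta>\<close> and \<open>z^N \<theta>\<close> lie in the image of \<open>A\<close>, for some
  \<open>N\<close>. Because \<open>x^N, y^N, z^N\<close> is a regular sequence and the image of \<open>A\<close> has a free resolution of length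
  one, \<open>\<theta>\<close> itself lies in the image (\<open>mat_image_saturated\<close>).
\<close>

section \<open>Coefficients, evaluation and derivatives\<close>

lemma poly3_eqI: "(\<And>i j k. coeff3 p i j k = coeff3 q i j k) \<Longrightarrow> p = q"
  unfolding coeff3_def by (intro poly_eqI) auto

lemma coeff3_0 [simp]: "coeff3 0 i j k = 0"
  and coeff3_add [simp]: "coeff3 (p + q) i j k = coeff3 p i j k + coeff3 q i j k"
  and coeff3_minus [simp]: "coeff3 (- p) i j k = - coeff3 p i j k"
  by (simp_all add: coeff3_def)

lemma coeff3_sum: "coeff3 (\<Sum>a\<in>A. g a) i j k = (\<Sum>a\<in>A. coeff3 (g a) i j k)"
  by (simp add: coeff3_def coeff_sum)

lemma coeff3_mult:
  "coeff3 (p * q) i j k =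
     (\<Sum>c\<le>k. \<Sum>b\<le>j. \<Sum>a\<le>i. coeff3 p a b c * coeff3 q (i - a) (j - b) (k - c))"
  by (simp add: coeff3_def coeff_mult coeff_sum)

definition const3 :: "complex \<Rightarrow> poly3" where
  "const3 c = [:[:[:c:]:]:]"

lemma const3_simps [simp]: "const3 0 = 0" "const3 1 = 1"
  by (simp_all add: const3_def one_pCons)

lemma const3_add: "const3 (a + b) = const3 a + const3 b"
  and const3_diff: "const3 (a - b) = const3 a - const3 b"
  and const3_mult: "const3 (a * b) = const3 a * const3 b"
  by (simp_all add: const3_def)

lemma const3_of_nat: "const3 (of_nat n) = of_nat n"
  by (induction n) (simp_all add: const3_add)

lemma const3_sum: "const3 (\<Sum>a\<in>A. g a) = (\<Sum>a\<in>A. const3 (g a))"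
  by (induction A rule: infinite_finite_induct) (simp_all add: const3_add)

lemma const3_eq_0_iff [simp]: "const3 c = 0 \<longleftrightarrow> c = 0"
  by (simp add: const3_def)

lemma coeff3_const3: "coeff3 (const3 c) i j k = (if i = 0 \<and> j = 0 \<and> k = 0 then c else 0)"
  by (auto simp: const3_def coeff3_def coeff_pCons split: nat.splits)

lemma coeff3_const3_mult [simp]: "coeff3 (const3 c * p) i j k = c * coeff3 p i j k"
  by (simp add: const3_def coeff3_def)

lemma coeff3_varx_mult: "coeff3 (varx * p) i j k = (if i = 0 then 0 else coeff3 p (i - 1) j k)"
  and coeff3_vary_mult: "coeff3 (vary * p) i j k = (if j = 0 then 0 else coeff3 p i (j - 1) k)"
  and coeff3_varz_mult: "coeff3 (varz * p) i j k = (if k = 0 then 0 else coeff3 p i j (k - 1))"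
  by (auto simp: varx_def vary_def varz_def coeff3_def coeff_pCons split: nat.splits)

lemma coeff3_pdx: "coeff3 (pdx p) i j k = of_nat (Suc i) * coeff3 p (Suc i) j k"
  and coeff3_pdy: "coeff3 (pdy p) i j k = of_nat (Suc j) * coeff3 p i (Suc j) k"
  and coeff3_pdz: "coeff3 (pdz p) i j k = of_nat (Suc k) * coeff3 p i j (Suc k)"
  by (simp_all add: pdx_def pdy_def pdz_def coeff3_def coeff_map_poly coeff_pderiv
      of_nat_poly del: of_nat_Suc)

text \<open>
  Applying a derivation to the coefficients is again a derivation; used once for \<open>y\<close>, and twice,
  one level inside the other, for \<open>x\<close>.
\<close>

lemma map_poly_derivation:
  fixes D :: "'a :: comm_ring_1 \<Rightarrow> 'a"
  assumes add: "\<And>a b. D (a + b) = D a + D b"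
    and mult: "\<And>a b. D (a * b) = a * D b + b * D a"
  shows "map_poly D (p + q) = map_poly D p + map_poly D q"
    and "map_poly D (p * q) = p * map_poly D q + q * map_poly D p"
proof -
  have D0: "D 0 = 0"
    using add[of 0 0] by simp
  have Dsum: "D (\<Sum>a\<in>A. g a) = (\<Sum>a\<in>A. D (g a))" for A :: "nat set" and g
    by (induction A rule: infinite_finite_induct) (simp_all add: D0 add)
  show "map_poly D (p + q) = map_poly D p + map_poly D q"
    by (intro poly_eqI) (simp add: coeff_map_poly D0 add)
  have "coeff (map_poly D (p * q)) n = coeff (p * map_poly D q + map_poly D p * q) n" for n
    by (simp add: coeff_map_poly D0 coeff_mult Dsum mult sum.distrib mult.commute[of "coeff q _"])
  then show "map_poly D (p * q) = p * map_poly D q + q * map_poly D p"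
    by (intro poly_eqI) (simp add: mult.commute)
qed

lemma pdz_mult: "pdz (p * q) = p * pdz q + q * pdz p"
  by (simp add: pdz_def pderiv_mult)

lemma pdy_mult: "pdy (p * q) = p * pdy q + q * pdy p"
  unfolding pdy_def
  by (rule map_poly_derivation; simp add: pderiv_add pderiv_mult)+

lemma pdx_mult: "pdx (p * q) = p * pdx q + q * pdx p"
  unfolding pdx_def
  by (rule map_poly_derivation;
      rule map_poly_derivation; simp add: pderiv_add pderiv_mult)+

lemma pd_const3 [simp]: "pdx (const3 c) = 0" "pdy (const3 c) = 0" "pdz (const3 c) = 0"
  by (rule poly3_eqI; simp add: coeff3_pdx coeff3_pdy coeff3_pdz coeff3_const3)+

lemma pd_one [simp]: "pdx 1 = 0" "pdy 1 = 0" "pdz 1 = 0"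
  using pd_const3[of 1] by simp_all

lemma pd_var [simp]:
  "pdx varx = 1" "pdx vary = 0" "pdx varz = 0"
  "pdy varx = 0" "pdy vary = 1" "pdy varz = 0"
  "pdz varx = 0" "pdz vary = 0" "pdz varz = 1"
  by (simp_all add: varx_def vary_def varz_def pdx_def pdy_def pdz_def map_poly_pCons
      pderiv_pCons one_pCons)

lemma derivation_prod:
  fixes D :: "'a :: comm_ring_1 \<Rightarrow> 'a"
  assumes "finite A" and one: "D 1 = 0" and mult: "\<And>a b. D (a * b) = a * D b + b * D a"
  shows "D (\<Prod>k\<in>A. g k) = (\<Sum>i\<in>A. (\<Prod>k\<in>A - {i}. g k) * D (g i))"
  using assms(1)
proof induction
  case (insert a A)
  have "(\<Prod>k\<in>insert a A - {i}. g k) = g a * (\<Prod>k\<in>A - {i}. g k)" if "i \<in> A" for i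
  proof -
    have "insert a A - {i} = insert a (A - {i})" using insert that by auto
    then show ?thesis using insert by simp
  qed
  then have "(\<Sum>i\<in>A. (\<Prod>k\<in>insert a A - {i}. g k) * D (g i)) = g a * D (\<Prod>k\<in>A. g k)"
    unfolding insert.IH sum_distrib_left by (intro sum.cong) (simp_all add: mult.assoc)
  then show ?case
    using insert by (simp add: mult add.commute)
qed (simp add: one)

lemmas pd_prod =
  derivation_prod[of _ pdx, OF _ pd_one(1) pdx_mult]
  derivation_prod[of _ pdy, OF _ pd_one(2) pdy_mult]
  derivation_prod[of _ pdz, OF _ pd_one(3) pdz_mult]

lemma eval3_add [simp]: "eval3 (p + q) a b c = eval3 p a b c + eval3 q a b c"
  and eval3_diff [simp]: "eval3 (p - q) a b c = eval3 p a b c - eval3 q a b c"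
  and eval3_mult [simp]: "eval3 (p * q) a b c = eval3 p a b c * eval3 q a b c"
  and eval3_0 [simp]: "eval3 0 a b c = 0"
  and eval3_1 [simp]: "eval3 1 a b c = 1"
  and eval3_const3 [simp]: "eval3 (const3 r) a b c = r"
  and eval3_var [simp]: "eval3 varx a b c = a" "eval3 vary a b c = b" "eval3 varz a b c = c"
  by (simp_all add: eval3_def const3_def varx_def vary_def varz_def)

lemma eval3_sum [simp]: "eval3 (\<Sum>i\<in>A. g i) a b c = (\<Sum>i\<in>A. eval3 (g i) a b c)"
  by (induction A rule: infinite_finite_induct) simp_all

lemma eval3_prod [simp]: "eval3 (\<Prod>i\<in>A. g i) a b c = (\<Prod>i\<in>A. eval3 (g i) a b c)"
  by (induction A rule: infinite_finite_induct) simp_all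

lemma eval3_power [simp]: "eval3 (p ^ n) a b c = eval3 p a b c ^ n"
  by (induction n) simp_all

section \<open>Monomials\<close>

definition mono3 :: "nat \<Rightarrow> nat \<Rightarrow> nat \<Rightarrow> poly3" where
  "mono3 i j k = varx ^ i * vary ^ j * varz ^ k"

lemma coeff3_mono3:
  "coeff3 (mono3 i j k) i' j' k' = (if i' = i \<and> j' = j \<and> k' = k then 1 else 0)"
proof -
  have 1: "coeff3 (varx ^ i * p) i' j' k' = (if i' < i then 0 else coeff3 p (i' - i) j' k')"
    for i p i' j' k'
    by (induction i arbitrary: i') (auto simp: mult.assoc coeff3_varx_mult)
  have 2: "coeff3 (vary ^ j * p) i' j' k' = (if j' < j then 0 else coeff3 p i' (j' - j) k')"
    for j p i' j' k'
    by (induction j arbitrary: j') (auto simp: mult.assoc coeff3_vary_mult)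
  have 3: "coeff3 (varz ^ k * p) i' j' k' = (if k' < k then 0 else coeff3 p i' j' (k' - k))"
    for k p i' j' k'
    by (induction k arbitrary: k') (auto simp: mult.assoc coeff3_varz_mult)
  show ?thesis
    using coeff3_const3[of 1 "i' - i" "j' - j" "k' - k"] 3[of k 1 "i' - i" "j' - j" k']
    by (auto simp: mono3_def mult.assoc 1 2)
qed

text \<open>
  Bounding each exponent by the same number, rather than the total degree, makes the monomials
  in question a product of three intervals; they span a space of finite dimension.
\<close>

definition box_bounded :: "nat \<Rightarrow> poly3 \<Rightarrow> bool" where
  "box_bounded B p \<longleftrightarrow> (\<forall>i j k. coeff3 p i j k \<noteq> 0 \<longrightarrow> i \<le> B \<and> j \<le> B \<and> k \<le> B)"

lemma ex_box_bounded: "\<exists>B. box_bounded B p"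
proof -
  define d2 where "d2 = (\<Sum>k\<le>degree p. degree (coeff p k))"
  define d1 where "d1 = (\<Sum>k\<le>degree p. \<Sum>j\<le>d2. degree (coeff (coeff p k) j))"
  have "i \<le> d1 \<and> j \<le> d2 \<and> k \<le> degree p" if "coeff3 p i j k \<noteq> 0" for i j k
  proof -
    have k: "k \<le> degree p"
      using that by (intro le_degree) (auto simp: coeff3_def)
    have "j \<le> degree (coeff p k)"
      using that by (intro le_degree) (auto simp: coeff3_def)
    also have "\<dots> \<le> d2"
      unfolding d2_def using k by (intro member_le_sum) auto
    finally have j: "j \<le> d2" .
    have "i \<le> degree (coeff (coeff p k) j)"
      using that by (intro le_degree) (auto simp: coeff3_def)
    also have "\<dots> \<le> (\<Sum>j\<le>d2. degree (coeff (coeff p k) j))"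
      using j by (intro member_le_sum) auto
    also have "\<dots> \<le> d1"
      unfolding d1_def using k by (intro member_le_sum) auto
    finally show ?thesis using j k by simp
  qed
  then have "box_bounded (max d1 (max d2 (degree p))) p"
    by (force simp: box_bounded_def)
  then show ?thesis ..
qed

lemma box_expansion:
  assumes "box_bounded B p"
  shows "p = (\<Sum>(i, j, k) \<in> {..B} \<times> {..B} \<times> {..B}. const3 (coeff3 p i j k) * mono3 i j k)"
proof (rule poly3_eqI)
  fix i j k
  have "coeff3 (\<Sum>(a, b, c) \<in> {..B} \<times> {..B} \<times> {..B}. const3 (coeff3 p a b c) * mono3 a b c) i j k
      = (\<Sum>x \<in> {..B} \<times> {..B} \<times> {..B}. if x = (i, j, k) then coeff3 p i j k else 0)"
    unfolding coeff3_sum by (intro sum.cong) (auto simp: coeff3_mono3 split: if_splits)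
  also have "\<dots> = coeff3 p i j k"
    using assms by (subst sum.delta) (auto simp: box_bounded_def)
  finally show "coeff3 p i j k =
      coeff3 (\<Sum>(i, j, k) \<in> {..B} \<times> {..B} \<times> {..B}. const3 (coeff3 p i j k) * mono3 i j k) i j k"
    by simp
qed

section \<open>Homogeneous polynomials\<close>

lemma homogeneous_0 [simp]: "homogeneous n 0"
  by (simp add: homogeneous_def)

lemma homogeneous_add: "homogeneous n p \<Longrightarrow> homogeneous n q \<Longrightarrow> homogeneous n (p + q)"
  unfolding homogeneous_def coeff3_add by (metis add.right_neutral)

lemma homogeneous_minus: "homogeneous n p \<Longrightarrow> homogeneous n (- p)"
  by (simp add: homogeneous_def)

lemma homogeneous_diff: "homogeneous n p \<Longrightarrow> homogeneous n q \<Longrightarrow> homogeneous n (p - q)"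
  using homogeneous_add[of n p "- q"] by (simp add: homogeneous_minus)

lemma homogeneous_mult:
  assumes "homogeneous n p" and "homogeneous n' q"
  shows "homogeneous (n + n') (p * q)"
  unfolding homogeneous_def
proof (intro allI impI)
  fix i j k assume "coeff3 (p * q) i j k \<noteq> 0"
  then obtain c where c: "c \<le> k"
    and "(\<Sum>b\<le>j. \<Sum>a\<le>i. coeff3 p a b c * coeff3 q (i - a) (j - b) (k - c)) \<noteq> 0"
    unfolding coeff3_mult by (auto elim: sum.not_neutral_contains_not_neutral)
  then obtain b where b: "b \<le> j"
    and "(\<Sum>a\<le>i. coeff3 p a b c * coeff3 q (i - a) (j - b) (k - c)) \<noteq> 0"
    by (auto elim: sum.not_neutral_contains_not_neutral)
  then obtain a where a: "a \<le> i"
    and "coeff3 p a b c * coeff3 q (i - a) (j - b) (k - c) \<noteq> 0"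
    by (auto elim: sum.not_neutral_contains_not_neutral)
  then have "int (a + b + c) = n" "int ((i - a) + (j - b) + (k - c)) = n'"
    using assms unfolding homogeneous_def by fastforce+
  then show "int (i + j + k) = n + n'"
    using a b c by auto
qed

lemma homogeneous_const3: "homogeneous 0 (const3 c)"
  by (auto simp: homogeneous_def coeff3_const3)

lemma homogeneous_1: "homogeneous 0 1"
  using homogeneous_const3[of 1] by simp

lemma homogeneous_prod:
  "(\<And>a. a \<in> A \<Longrightarrow> homogeneous (n a) (g a)) \<Longrightarrow> homogeneous (\<Sum>a\<in>A. n a) (\<Prod>a\<in>A. g a)"
  by (induction A rule: infinite_finite_induct) (simp_all add: homogeneous_mult homogeneous_1)

lemma homogeneous_var: "homogeneous 1 varx" "homogeneous 1 vary" "homogeneous 1 varz"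
  using coeff3_mono3[of 1 0 0] coeff3_mono3[of 0 1 0] coeff3_mono3[of 0 0 1]
  by (auto simp: homogeneous_def mono3_def split: if_splits)

lemma homogeneous_pd:
  assumes "homogeneous n p"
  shows "homogeneous (n - 1) (pdx p)" "homogeneous (n - 1) (pdy p)" "homogeneous (n - 1) (pdz p)"
  using assms unfolding homogeneous_def coeff3_pdx coeff3_pdy coeff3_pdz by fastforce+

lemma homogeneous_irrelevant: "homogeneous n p \<Longrightarrow> n > 0 \<Longrightarrow> p \<in> irrelevant_ideal"
  unfolding homogeneous_def irrelevant_ideal_def by force

lemma euler_identity:
  assumes "homogeneous (int n) p"
  shows "varx * pdx p + vary * pdy p + varz * pdz p = of_nat n * p"
proof (rule poly3_eqI)
  fix i j k
  have "of_nat (i + j + k) * coeff3 p i j k = of_nat n * coeff3 p i j k"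
    using assms unfolding homogeneous_def by (metis mult_zero_right of_nat_eq_iff)
  moreover have "coeff3 (varx * pdx p + vary * pdy p + varz * pdz p) i j k
      = of_nat (i + j + k) * coeff3 p i j k"
    by (simp add: coeff3_varx_mult coeff3_vary_mult coeff3_varz_mult
        coeff3_pdx coeff3_pdy coeff3_pdz algebra_simps)
  ultimately show "coeff3 (varx * pdx p + vary * pdy p + varz * pdz p) i j k
      = coeff3 (of_nat n * p) i j k"
    by (simp flip: const3_of_nat)
qed

lemma homogeneous_line_degree:
  shows "homogeneous (int n) varx \<Longrightarrow> n = 1" and "homogeneous (int n) vary \<Longrightarrow> n = 1"
proof -
  have x: "coeff3 varx 1 0 0 \<noteq> 0" and y: "coeff3 vary 0 1 0 \<noteq> 0"
    using coeff3_mono3[of 1 0 0 1 0 0] coeff3_mono3[of 0 1 0 0 1 0] by (simp_all add: mono3_def)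
  show "n = 1" if "homogeneous (int n) varx"
    using that[unfolded homogeneous_def, rule_format, OF x] by simp
  show "n = 1" if "homogeneous (int n) vary"
    using that[unfolded homogeneous_def, rule_format, OF y] by simp
qed

text \<open>
  A homogeneous polynomial of degree zero is constant, hence zero or a unit.
\<close>

lemma irreducible_homogeneous_pos:
  assumes p: "irreducible p" "homogeneous (int n) p"
  shows "0 < n"
proof (rule ccontr)
  assume "\<not> 0 < n"
  then have "p = const3 (coeff3 p 0 0 0)"
    using p(2) by (intro poly3_eqI) (force simp: homogeneous_def coeff3_const3)
  then obtain c where c: "p = const3 c" ..
  then have "c \<noteq> 0" using p(1) by auto
  then have "p * const3 (1 / c) = 1" by (simp add: c const3_mult[symmetric])
  then have "p dvd 1" by (metis dvd_triv_left)
  then show False using p(1) by (simp add: irreducible_def)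
qed

text \<open>
  The total degree of the leading monomial for the lexicographic order with \<open>z > y > x\<close>. It is additive
  on products because leading coefficients multiply in a domain, and it is the degree of every nonzero homogeneous
  polynomial; so it shows that a homogeneous divisor of a nonzero homogeneous polynomial cannot have larger
  degree, without decomposing the quotient into homogeneous parts.
\<close>

definition lead_total_degree :: "poly3 \<Rightarrow> nat" where
  "lead_total_degree p =
     degree p + degree (lead_coeff p) + degree (lead_coeff (lead_coeff p))"

lemma lead_total_degree_homogeneous:
  assumes "homogeneous n p" "p \<noteq> 0"
  shows "int (lead_total_degree p) = n"
proof -
  have "coeff3 p (degree (lead_coeff (lead_coeff p))) (degree (lead_coeff p)) (degree p) \<noteq> 0"
    using assms(2) by (simp add: coeff3_def)
  then show ?thesis
    using assms(1) unfolding homogeneous_def lead_total_degree_def by fastforce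
qed

lemma homogeneous_not_dvd:
  assumes "homogeneous n p" and "homogeneous k q" and "k < n" and "q \<noteq> 0"
  shows "\<not> p dvd q"
proof
  assume "p dvd q"
  then obtain r where q: "q = p * r" ..
  then have "p \<noteq> 0" "r \<noteq> 0" using assms(4) by auto
  then have "lead_total_degree q = lead_total_degree p + lead_total_degree r"
    unfolding q lead_total_degree_def lead_coeff_mult by (simp add: degree_mult_eq)
  then show False
    using lead_total_degree_homogeneous[OF assms(1) \<open>p \<noteq> 0\<close>]
      lead_total_degree_homogeneous[OF assms(2,4)] assms(3) by simp
qed

section \<open>A homogeneous Nullstellensatz\<close>

definition ideal3 :: "poly3 set \<Rightarrow> bool" where
  "ideal3 I \<longleftrightarrow> 0 \<in> I \<and> (\<forall>p\<in>I. \<forall>q\<in>I. p + q \<in> I) \<and> (\<forall>p. \<forall>q\<in>I. p * q \<in> I)"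

lemma ideal3D:
  assumes "ideal3 I"
  shows "0 \<in> I" "p \<in> I \<Longrightarrow> q \<in> I \<Longrightarrow> p + q \<in> I" "q \<in> I \<Longrightarrow> r * q \<in> I" "q \<in> I \<Longrightarrow> q * r \<in> I"
  using assms unfolding ideal3_def by (auto, metis mult.commute)

lemma ideal3_diff: "ideal3 I \<Longrightarrow> p \<in> I \<Longrightarrow> q \<in> I \<Longrightarrow> p - q \<in> I"
  using ideal3D(2)[of I p "- 1 * q"] ideal3D(3)[of I q "- 1"] by simp

lemma ideal3_sum: "ideal3 I \<Longrightarrow> (\<And>a. a \<in> A \<Longrightarrow> g a \<in> I) \<Longrightarrow> (\<Sum>a\<in>A. g a) \<in> I"
  by (induction A rule: infinite_finite_induct) (auto simp: ideal3D)

lemma ideal3_cong_mult: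
  assumes I: "ideal3 I" and p: "p - p' \<in> I" and q: "q - q' \<in> I"
  shows "p * q - p' * q' \<in> I"
proof -
  have "p * q - p' * q' = (p - p') * q + p' * (q - q')"
    by (simp add: algebra_simps)
  then show ?thesis
    using ideal3D(2)[OF I ideal3D(4)[OF I p, of q] ideal3D(3)[OF I q, of p']] by simp
qed

lemma ideal3_cong_power: "ideal3 I \<Longrightarrow> p - q \<in> I \<Longrightarrow> p ^ n - q ^ n \<in> I"
  by (induction n) (simp_all add: ideal3_cong_mult ideal3D)

text \<open>
  The ideals that are maximal among those containing no power of \<open>u\<close>; they are the contractions of
  the maximal ideals of the localization at \<open>u\<close>. The last clause says that every larger
  ideal \<open>M + (a)\<close> does contain a power of \<open>u\<close>.
\<close>

definition maximal_avoiding :: "poly3 \<Rightarrow> poly3 set \<Rightarrow> bool" where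
  "maximal_avoiding u M \<longleftrightarrow> ideal3 M \<and> (\<forall>n. u ^ n \<notin> M) \<and>
     (\<forall>a. a \<notin> M \<longrightarrow> (\<exists>n q. u ^ n - q * a \<in> M))"

lemma maximal_avoidingD:
  assumes "maximal_avoiding u M"
  shows "ideal3 M" "u ^ n \<notin> M" "a \<notin> M \<Longrightarrow> \<exists>n q. u ^ n - q * a \<in> M"
  using assms by (simp_all add: maximal_avoiding_def)

lemma ex_maximal_avoiding:
  assumes I: "ideal3 I" and u: "\<And>n. u ^ n \<notin> I"
  obtains M where "maximal_avoiding u M" "I \<subseteq> M"
proof -
  define A where "A = {K. ideal3 K \<and> I \<subseteq> K \<and> (\<forall>n. u ^ n \<notin> K)}"
  have "\<exists>M\<in>A. \<forall>X\<in>A. M \<subseteq> X \<longrightarrow> X = M"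
  proof (rule subset_Zorn_nonempty)
    show "A \<noteq> {}"
      using I u by (auto simp: A_def)
    fix C assume C: "C \<noteq> {}" "subset.chain A C"
    then have CA: "C \<subseteq> A" and cmp: "\<And>X Y. X \<in> C \<Longrightarrow> Y \<in> C \<Longrightarrow> X \<subseteq> Y \<or> Y \<subseteq> X"
      by (auto simp: subset_chain_def)
    have "ideal3 (\<Union>C)"
      unfolding ideal3_def
    proof (intro conjI ballI allI)
      show "0 \<in> \<Union>C"
        using C(1) CA ideal3D(1) by (force simp: A_def)
    next
      fix p q assume "p \<in> \<Union>C" "q \<in> \<Union>C"
      then obtain X Y where XY: "X \<in> C" "Y \<in> C" "p \<in> X" "q \<in> Y" by auto
      then obtain Z where "Z \<in> C" "p \<in> Z" "q \<in> Z" using cmp[of X Y] by blast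
      moreover from this have "p + q \<in> Z" using CA by (auto simp: A_def intro: ideal3D(2))
      ultimately show "p + q \<in> \<Union>C" by blast
    next
      fix p q assume "q \<in> \<Union>C"
      then show "p * q \<in> \<Union>C" using CA by (auto simp: A_def intro: ideal3D(3))
    qed
    then show "\<Union>C \<in> A"
      using C(1) CA by (auto simp: A_def)
  qed
  then obtain M where M: "M \<in> A" and max: "\<And>X. X \<in> A \<Longrightarrow> M \<subseteq> X \<Longrightarrow> X = M" by blast
  then have iM: "ideal3 M" and IM: "I \<subseteq> M" and uM: "\<And>n. u ^ n \<notin> M" by (auto simp: A_def)
  have "\<exists>n q. u ^ n - q * a \<in> M" if a: "a \<notin> M" for a
  proof (rule ccontr)
    assume no: "\<nexists>n q. u ^ n - q * a \<in> M"
    define K where "K = {p. \<exists>q. p - q * a \<in> M}"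
    have "ideal3 K"
      unfolding ideal3_def
    proof (intro conjI ballI allI)
      show "0 \<in> K" using ideal3D(1)[OF iM] by (auto simp: K_def intro: exI[of _ 0])
    next
      fix p q assume "p \<in> K" "q \<in> K"
      then obtain r s where "p - r * a \<in> M" "q - s * a \<in> M" by (auto simp: K_def)
      then have "p + q - (r + s) * a \<in> M"
        using ideal3D(2)[OF iM] by (force simp: algebra_simps)
      then show "p + q \<in> K" by (auto simp: K_def)
    next
      fix p q assume "q \<in> K"
      then obtain s where "q - s * a \<in> M" by (auto simp: K_def)
      then have "p * q - (p * s) * a \<in> M"
        using ideal3D(3)[OF iM, of _ p] by (force simp: algebra_simps)
      then show "p * q \<in> K" by (auto simp: K_def)
    qed
    moreover have MK: "M \<subseteq> K" by (auto simp: K_def intro: exI[of _ 0])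
    moreover have "u ^ n \<notin> K" for n using no by (auto simp: K_def)
    ultimately have "K \<in> A" using IM by (auto simp: A_def)
    then have "K = M" using max MK by blast
    moreover have "a \<in> K" using ideal3D(1)[OF iM] by (auto simp: K_def intro: exI[of _ 1])
    ultimately show False using a by simp
  qed
  then have "maximal_avoiding u M" using iM uM by (simp add: maximal_avoiding_def)
  then show thesis using that IM by blast
qed

lemma maximal_avoiding_prime:
  assumes M: "maximal_avoiding u M" and ab: "a * b \<in> M"
  shows "a \<in> M \<or> b \<in> M"
proof (rule ccontr)
  assume "\<not> ?thesis"
  then have "a \<notin> M" "b \<notin> M" by simp_all
  then obtain n q k r where 1: "u ^ n - q * a \<in> M" "u ^ k - r * b \<in> M"
    using maximal_avoidingD(3)[OF M] by metis
  note iM = maximal_avoidingD(1)[OF M]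
  have "u ^ n * u ^ k - (q * a) * (r * b) \<in> M"
    using ideal3_cong_mult[OF iM 1] .
  moreover have "(q * r) * (a * b) \<in> M"
    using ideal3D(3)[OF iM ab] .
  ultimately have "(u ^ n * u ^ k - (q * a) * (r * b)) + (q * r) * (a * b) \<in> M"
    using ideal3D(2)[OF iM] by blast
  also have "(u ^ n * u ^ k - (q * a) * (r * b)) + (q * r) * (a * b) = u ^ (n + k)"
    by (simp add: power_add algebra_simps)
  finally show False using maximal_avoidingD(2)[OF M] by simp
qed

text \<open>form\<close>
text \<open>
  The homogenization of \<open>P\<close> to degree \<open>n\<close>, with \<open>t\<close> and \<open>u\<close> substituted for the two variables.
\<close>

definition binary_form :: "poly3 \<Rightarrow> poly3 \<Rightarrow> nat \<Rightarrow> complex poly \<Rightarrow> poly3" where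
  "binary_form t u n P = (\<Sum>i\<le>n. const3 (coeff P i) * t ^ i * u ^ (n - i))"

lemma binary_form_add: "binary_form t u n (P + Q) = binary_form t u n P + binary_form t u n Q"
  and binary_form_smult: "binary_form t u n (smult r P) = const3 r * binary_form t u n P"
  by (simp_all add: binary_form_def const3_add const3_mult sum.distrib sum_distrib_left
      algebra_simps)

lemma binary_form_sum:
  "binary_form t u n (\<Sum>a\<in>A. P a) = (\<Sum>a\<in>A. binary_form t u n (P a))"
proof (induction A rule: infinite_finite_induct)
  case (insert a A)
  then show ?case by (simp add: binary_form_add)
qed (simp_all add: binary_form_def)

lemma binary_form_linear_factor:
  assumes "degree P \<le> n"
  shows "binary_form t u (Suc n) ([:- r, 1:] * P) = (t - const3 r * u) * binary_form t u n P"
proof -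
  have "binary_form t u (Suc n) (pCons 0 P) = t * binary_form t u n P"
    unfolding binary_form_def sum.atMost_Suc_shift
    by (simp add: sum_distrib_left algebra_simps)
  moreover have "binary_form t u (Suc n) P = u * binary_form t u n P"
  proof -
    have "coeff P (Suc n) = 0" using assms by (intro coeff_eq_0) simp
    then show ?thesis
      by (simp add: binary_form_def sum_distrib_left Suc_diff_le algebra_simps)
  qed
  moreover have "[:- r, 1:] * P = pCons 0 P + smult (- r) P"
    by (simp add: add.commute)
  ultimately show ?thesis
    using const3_diff[of 0 r]
    by (simp only: binary_form_add binary_form_smult) (simp add: algebra_simps)
qed

lemma binary_form_prod:
  assumes "finite T"
  shows "binary_form t u (card T) (\<Prod>c\<in>T. [:- c, 1:]) = (\<Prod>c\<in>T. t - const3 c * u)"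
  using assms
proof induction
  case (insert c T)
  have "degree (\<Prod>c\<in>T. [:- c, 1:]) \<le> card T"
    using degree_prod_sum_le[OF insert(1), of "\<lambda>c. [:- c, 1:]"] by simp
  then have "binary_form t u (Suc (card T)) ([:- c, 1:] * (\<Prod>c\<in>T. [:- c, 1:]))
      = (t - const3 c * u) * binary_form t u (card T) (\<Prod>c\<in>T. [:- c, 1:])"
    by (rule binary_form_linear_factor)
  then show ?case using insert by simp
qed (simp add: binary_form_def)

text \<open>
  Over the complex numbers the form is a product of linear factors \<open>t - r u\<close> and a power of \<open>u\<close>, none
  of which is in the prime ideal.
\<close>

lemma binary_form_notin:
  assumes M: "maximal_avoiding u M" and t: "\<And>c. t - const3 c * u \<notin> M"
    and "P \<noteq> 0" "degree P \<le> n"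
  shows "binary_form t u n P \<notin> M"
  using assms(3,4)
proof (induction "degree P" arbitrary: P n)
  case 0
  then obtain r where r: "P = [:r:]" "r \<noteq> 0" by (metis degree_eq_zeroE pCons_0_0)
  have "binary_form t u n P = (\<Sum>i\<le>n. if i = 0 then const3 r * u ^ n else 0)"
    unfolding binary_form_def r by (intro sum.cong) (auto simp: coeff_pCons split: nat.splits)
  then have "const3 (1 / r) * binary_form t u n P = u ^ n"
    using r by (simp add: mult.assoc[symmetric] const3_mult[symmetric])
  then show ?case
    using maximal_avoidingD(2)[OF M, of n]
      ideal3D(3)[OF maximal_avoidingD(1)[OF M], of "binary_form t u n P" "const3 (1 / r)"] by auto
next
  case (Suc k)
  have "\<not> constant (poly P)" using Suc(2) by (simp add: constant_degree)
  then obtain r where "poly P r = 0" using fundamental_theorem_of_algebra by blast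
  then obtain Q where Q: "P = [:- r, 1:] * Q" by (auto simp: poly_eq_0_iff_dvd elim: dvdE)
  then have "Q \<noteq> 0" using Suc by auto
  then have "degree P = Suc (degree Q)" unfolding Q by (subst degree_mult_eq) auto
  with Suc obtain n' where n: "n = Suc n'" "degree Q \<le> n'" "degree Q = k" by (cases n) auto
  have "binary_form t u n' Q \<notin> M" using Suc(1)[of Q n'] n \<open>Q \<noteq> 0\<close> by auto
  then show ?case
    unfolding Q n(1) binary_form_linear_factor[OF n(2)]
    using maximal_avoiding_prime[OF M, of "t - const3 r * u"] t[of r] by auto
qed

lemma vector_space_poly3: "vector_space (\<lambda>c p. const3 c * p)"
  by unfold_locales (simp_all add: const3_add const3_mult algebra_simps)

text \<open>
  The residue field of the localization at \<open>u\<close> is the complex numbers, so \<open>t / u\<close> is congruent to a constant. If it were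
  not, \<open>t - c u\<close> would be invertible up to a power of \<open>u\<close> for each of the uncountably many constants \<open>c\<close>. As the polynomial ring has
  countable dimension, the inverses would be linearly dependent, and clearing denominators in a dependence
  puts a nonzero binary form in \<open>t\<close> and \<open>u\<close> into the ideal, contrary to \<open>binary_form_notin\<close>.
\<close>

lemma linear_form_in_maximal_avoiding:
  assumes M: "maximal_avoiding u M"
  shows "\<exists>c. t - const3 c * u \<in> M"
proof (rule ccontr)
  assume "\<nexists>c. t - const3 c * u \<in> M"
  then have t: "\<And>c. t - const3 c * u \<notin> M" by blast
  note iM = maximal_avoidingD(1)[OF M] and uM = maximal_avoidingD(2)[OF M]
  have "\<forall>c. \<exists>n q. u ^ n - q * (t - const3 c * u) \<in> M"
    using maximal_avoidingD(3)[OF M t] by blast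
  then obtain n q where nq: "\<And>c. u ^ n c - q c * (t - const3 c * u) \<in> M" by metis
  have "\<forall>c. \<exists>B. box_bounded B (q c)" using ex_box_bounded by blast
  then obtain b where b: "\<And>c. box_bounded (b c) (q c)" by metis
  \<comment> \<open>Some power of \<open>u\<close> and some box of exponents serve infinitely many constants.\<close>
  have "\<exists>N B. infinite {c. n c = N \<and> b c = B}"
  proof (rule ccontr)
    assume "\<nexists>N B. infinite {c. n c = N \<and> b c = B}"
    then have "countable (\<Union>(N, B) \<in> UNIV. {c. n c = N \<and> b c = B})"
      by (intro countable_UN) (auto intro: countable_finite)
    also have "(\<Union>(N, B) \<in> UNIV. {c. n c = N \<and> b c = B}) = (UNIV :: complex set)" by auto
    finally show False using uncountable_UNIV_complex by simp
  qed
  then obtain N B where "infinite {c. n c = N \<and> b c = B}" by blast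
  moreover define C where "C = {c. n c = N \<and> b c = B}"
  ultimately have C: "infinite C" by simp
  have nqC: "u ^ N - q c * (t - const3 c * u) \<in> M" if "c \<in> C" for c
    using nq[of c] that by (simp add: C_def)
  have inj: "inj_on q C"
  proof (rule inj_onI, rule ccontr)
    fix c c' assume c: "c \<in> C" "c' \<in> C" "q c = q c'" "c \<noteq> c'"
    have "(u ^ N - q c * (t - const3 c * u)) - (u ^ N - q c' * (t - const3 c' * u)) \<in> M"
      using ideal3_diff[OF iM] nqC c by blast
    moreover have "(u ^ N - q c * (t - const3 c * u)) - (u ^ N - q c' * (t - const3 c' * u))
        = const3 (c - c') * (q c * u)"
      unfolding c(3) by (simp add: const3_diff algebra_simps)
    ultimately have "const3 (1 / (c - c')) * (const3 (c - c') * (q c * u)) \<in> M"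
      using ideal3D(3)[OF iM] by simp
    then have "q c * u \<in> M"
      using c(4) by (simp add: mult.assoc[symmetric] const3_mult[symmetric])
    then have "q c \<in> M"
      using maximal_avoiding_prime[OF M] uM[of 1] by auto
    then have "(u ^ N - q c * (t - const3 c * u)) + q c * (t - const3 c * u) \<in> M"
      using ideal3D[OF iM] nqC c by blast
    then show False using uM by simp
  qed
  interpret V: vector_space "\<lambda>c p. const3 c * p" by (rule vector_space_poly3)
  define X where "X = (\<lambda>(i, j, k). mono3 i j k) ` ({..B} \<times> {..B} \<times> {..B})"
  have "q c \<in> V.span X" if "c \<in> C" for c
  proof -
    have "box_bounded B (q c)" using b[of c] that by (simp add: C_def)
    note box_expansion[OF this]
    also have "(\<Sum>(i, j, k) \<in> {..B} \<times> {..B} \<times> {..B}. const3 (coeff3 (q c) i j k) * mono3 i j k)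
        \<in> V.span X"
    proof (rule V.span_sum, clarify)
      fix i j k assume "i \<le> B" "j \<le> B" "k \<le> B"
      then have "mono3 i j k \<in> X" by (force simp: X_def)
      then show "const3 (coeff3 (q c) i j k) * mono3 i j k \<in> V.span X"
        by (intro V.span_scale V.span_base)
    qed
    finally show ?thesis .
  qed
  moreover have "finite X" by (simp add: X_def)
  moreover have "infinite (q ` C)" using C inj by (simp add: finite_image_iff)
  ultimately have "V.dependent (q ` C)"
    using V.independent_span_bound[of X "q ` C"] by blast
  then obtain Y l where Y: "finite Y" "Y \<subseteq> q ` C" "(\<Sum>v\<in>Y. const3 (l v) * v) = 0" "\<exists>v\<in>Y. l v \<noteq> 0"
    unfolding V.dependent_explicit by blast
  then obtain T where T: "T \<subseteq> C" "finite T" "Y = q ` T" by (meson finite_subset_image)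
  have injT: "inj_on q T" using inj T by (meson inj_on_subset)
  define g where "g c = l (q c)" for c
  have rel: "(\<Sum>c\<in>T. const3 (g c) * q c) = 0"
    using Y(3) injT by (simp add: T(3) sum.reindex g_def)
  obtain c0 where c0: "c0 \<in> T" "g c0 \<noteq> 0" using Y(4) by (auto simp: T(3) g_def)
  \<comment> \<open>The numerator of \<open>\<Sum> g c / (X - c)\<close>; its value at \<open>c0\<close> shows that it is not zero.\<close>
  define P where "P = (\<Sum>c\<in>T. smult (g c) (\<Prod>c'\<in>T - {c}. [:- c', 1:]))"
  define L where "L c = t - const3 c * u" for c
  have "poly P c0 = (\<Sum>c\<in>T. if c = c0 then g c0 * (\<Prod>c'\<in>T - {c0}. c0 - c') else 0)"
    unfolding P_def poly_sum
  proof (intro sum.cong refl)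
    fix c assume "c \<in> T"
    show "poly (smult (g c) (\<Prod>c'\<in>T - {c}. [:- c', 1:])) c0 =
        (if c = c0 then g c0 * (\<Prod>c'\<in>T - {c0}. c0 - c') else 0)"
      using T c0 by (auto simp: poly_prod)
  qed
  also have "\<dots> \<noteq> 0" using T c0 by simp
  finally have "P \<noteq> 0" by auto
  moreover have dP: "degree P \<le> card T - 1"
    unfolding P_def
  proof (intro degree_sum_le order.trans[OF degree_smult_le])
    fix c assume "c \<in> T"
    then show "degree (\<Prod>c'\<in>T - {c}. [:- c', 1:]) \<le> card T - 1"
      using T degree_prod_sum_le[of "T - {c}" "\<lambda>c. [:- c, 1:]"] by simp
  qed (rule T)
  ultimately have notin: "binary_form t u (card T - 1) P \<notin> M"
    by (rule binary_form_notin[OF M t])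
  have form: "binary_form t u (card T - 1) P = (\<Sum>c\<in>T. const3 (g c) * (\<Prod>c'\<in>T - {c}. L c'))"
    unfolding P_def binary_form_sum binary_form_smult L_def
  proof (intro sum.cong refl)
    fix c assume "c \<in> T"
    then show "const3 (g c) * binary_form t u (card T - 1) (\<Prod>c'\<in>T - {c}. [:- c', 1:])
        = const3 (g c) * (\<Prod>c'\<in>T - {c}. t - const3 c' * u)"
      using T(2) binary_form_prod[of "T - {c}" t u] by (simp add: card_Diff_singleton)
  qed
  have "u ^ N * binary_form t u (card T - 1) P
      = (\<Sum>c\<in>T. const3 (g c) * (u ^ N * (\<Prod>c'\<in>T - {c}. L c')))
        - (\<Sum>c\<in>T. const3 (g c) * q c) * (\<Prod>c'\<in>T. L c')"
    unfolding form rel by (simp add: sum_distrib_left algebra_simps)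
  also have "\<dots> = (\<Sum>c\<in>T. const3 (g c) * ((u ^ N - q c * L c) * (\<Prod>c'\<in>T - {c}. L c')))"
    unfolding sum_distrib_right sum_subtractf[symmetric]
    using T(2) by (intro sum.cong) (auto simp: prod.remove[of T _ L] algebra_simps)
  also have "\<dots> \<in> M"
    using nqC T(1) unfolding L_def
    by (intro ideal3_sum[OF iM] ideal3D(3)[OF iM] ideal3D(4)[OF iM]) auto
  finally show False
    using maximal_avoiding_prime[OF M, of "u ^ N"] uM[of N] notin by auto
qed

text \<open>
  Modulo \<open>x - a u\<close>, \<open>y - b u\<close> and \<open>z - c u\<close> the variables are multiples of \<open>u\<close>, and a homogeneous
  polynomial of degree \<open>n\<close> scales by \<open>u^n\<close>.
\<close>

lemma homogeneous_cong_eval3: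
  assumes I: "ideal3 I" and p: "homogeneous (int n) p"
    and x: "varx - const3 a * u \<in> I" and y: "vary - const3 b * u \<in> I" and z: "varz - const3 c * u \<in> I"
  shows "p - const3 (eval3 p a b c) * u ^ n \<in> I"
proof -
  obtain B where B: "box_bounded B p" using ex_box_bounded by blast
  define A where "A = {..B} \<times> {..B} \<times> {..B}"
  have exp: "p = (\<Sum>(i, j, k) \<in> A. const3 (coeff3 p i j k) * mono3 i j k)"
    unfolding A_def by (rule box_expansion[OF B])
  have "eval3 p a b c = (\<Sum>(i, j, k) \<in> A. coeff3 p i j k * (a ^ i * b ^ j * c ^ k))"
    by (subst exp) (simp add: case_prod_unfold mono3_def)
  then have "p - const3 (eval3 p a b c) * u ^ n = (\<Sum>(i, j, k) \<in> A. const3 (coeff3 p i j k) *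
      (mono3 i j k - const3 (a ^ i * b ^ j * c ^ k) * u ^ n))"
    by (subst exp) (simp add: case_prod_unfold const3_sum const3_mult sum_distrib_right
        right_diff_distrib sum_subtractf mult.assoc)
  also have "\<dots> \<in> I"
  proof (rule ideal3_sum[OF I], clarify)
    fix i j k
    have pow: "const3 (r ^ i) = const3 r ^ i" for r i
      by (induction i) (simp_all add: const3_mult)
    have "mono3 i j k - (const3 a * u) ^ i * (const3 b * u) ^ j * (const3 c * u) ^ k \<in> I"
      unfolding mono3_def by (intro ideal3_cong_mult ideal3_cong_power I x y z)
    also have "(const3 a * u) ^ i * (const3 b * u) ^ j * (const3 c * u) ^ k
        = const3 (a ^ i * b ^ j * c ^ k) * u ^ (i + j + k)"
      by (simp add: const3_mult pow power_mult_distrib power_add algebra_simps)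
    finally have "mono3 i j k - const3 (a ^ i * b ^ j * c ^ k) * u ^ (i + j + k) \<in> I" .
    moreover have "i + j + k = n" if "coeff3 p i j k \<noteq> 0"
      using p that unfolding homogeneous_def by (metis of_nat_eq_iff)
    ultimately show "const3 (coeff3 p i j k) *
        (mono3 i j k - const3 (a ^ i * b ^ j * c ^ k) * u ^ n) \<in> I"
      using ideal3D(1,3)[OF I] by (cases "coeff3 p i j k = 0") auto
  qed
  finally show ?thesis .
qed

text \<open>
  An ideal maximal among those avoiding the powers of \<open>u\<close> contains \<open>x - a u\<close>, \<open>y - b u\<close>, \<open>z - c u\<close>
  for suitable constants. Then \<open>(a, b, c)\<close> is a common zero of the
  homogeneous elements of the ideal; it is not the origin because \<open>u\<close> is one of the variables.
\<close>

theorem homogeneous_nullstellensatz: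
  assumes I: "ideal3 I" and GI: "G \<subseteq> I"
    and hom: "\<And>g. g \<in> G \<Longrightarrow> \<exists>n. homogeneous (int n) g"
    and nozero: "\<And>a b c. (a, b, c) \<noteq> (0, 0, 0) \<Longrightarrow> \<exists>g\<in>G. eval3 g a b c \<noteq> 0"
    and u: "u \<in> {varx, vary, varz}"
  shows "\<exists>N. u ^ N \<in> I"
proof (rule ccontr)
  assume "\<nexists>N. u ^ N \<in> I"
  then obtain M where M: "maximal_avoiding u M" and IM: "I \<subseteq> M"
    using ex_maximal_avoiding[OF I] by blast
  note iM = maximal_avoidingD(1)[OF M] and uM = maximal_avoidingD(2)[OF M]
  obtain a b c where abc: "varx - const3 a * u \<in> M" "vary - const3 b * u \<in> M" "varz - const3 c * u \<in> M"
    using linear_form_in_maximal_avoiding[OF M] by meson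
  have "(a, b, c) \<noteq> (0, 0, 0)"
    using u abc uM[of 1] by auto
  then obtain g where g: "g \<in> G" "eval3 g a b c \<noteq> 0" using nozero by blast
  obtain n where "homogeneous (int n) g" using hom g by blast
  then have "g - const3 (eval3 g a b c) * u ^ n \<in> M"
    using homogeneous_cong_eval3[OF iM] abc by blast
  moreover have "g \<in> M" using g GI IM by blast
  ultimately have "g - (g - const3 (eval3 g a b c) * u ^ n) \<in> M"
    using ideal3_diff[OF iM] by blast
  then have "const3 (1 / eval3 g a b c) * (const3 (eval3 g a b c) * u ^ n) \<in> M"
    using ideal3D(3)[OF iM] by simp
  then show False
    using g uM by (simp add: mult.assoc[symmetric] const3_mult[symmetric])
qed

section \<open>Saturation\<close>

lemma mult_mat_vec_smult:
  fixes A :: "'a :: comm_ring_1 mat"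
  assumes "A \<in> carrier_mat n p" "v \<in> carrier_vec p"
  shows "A *\<^sub>v (k \<cdot>\<^sub>v v) = k \<cdot>\<^sub>v (A *\<^sub>v v)"
  using assms by (intro eq_vecI) (auto simp: scalar_prod_smult_distrib[of _ p])

lemma mult_mat_vec_lincomb:
  fixes A :: "'a :: comm_ring_1 mat"
  assumes "A \<in> carrier_mat n p" "u \<in> carrier_vec p" "v \<in> carrier_vec p"
  shows "A *\<^sub>v (k \<cdot>\<^sub>v u - l \<cdot>\<^sub>v v) = k \<cdot>\<^sub>v (A *\<^sub>v u) - l \<cdot>\<^sub>v (A *\<^sub>v v)"
  using assms by (simp add: mult_minus_distrib_mat_vec mult_mat_vec_smult)

lemma mat_imageI: "A \<in> carrier_mat n p \<Longrightarrow> v \<in> carrier_vec p \<Longrightarrow> A *\<^sub>v v \<in> mat_image A"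
  by (auto simp: mat_image_def)

lemma mat_imageE:
  assumes "w \<in> mat_image A" "A \<in> carrier_mat n p"
  obtains v where "v \<in> carrier_vec p" "w = A *\<^sub>v v"
  using assms by (auto simp: mat_image_def)

lemma mat_image_carrier: "A \<in> carrier_mat n p \<Longrightarrow> mat_image A \<subseteq> carrier_vec n"
  by (auto simp: mat_image_def)

lemma mat_image_smult:
  fixes A :: "poly3 mat"
  assumes "A \<in> carrier_mat n p" "w \<in> mat_image A"
  shows "k \<cdot>\<^sub>v w \<in> mat_image A"
  using assms by (auto elim!: mat_imageE simp flip: mult_mat_vec_smult intro!: mat_imageI)

lemma mat_image_add:
  assumes "A \<in> carrier_mat n p" "u \<in> mat_image A" "w \<in> mat_image A"
  shows "u + w \<in> mat_image A"
  using assms by (auto elim!: mat_imageE simp flip: mult_add_distrib_mat_vec intro!: mat_imageI)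

lemma mat_image_0:
  assumes "A \<in> carrier_mat n p"
  shows "0\<^sub>v n \<in> mat_image A"
proof -
  have "A *\<^sub>v 0\<^sub>v p = 0\<^sub>v n" using assms by (intro eq_vecI) auto
  then show ?thesis using mat_imageI[OF assms, of "0\<^sub>v p"] by simp
qed

lemma coprime_varx_vary: "coprime varx vary"
proof (rule prime_elem_imp_coprime)
  show "prime_elem varx"
    unfolding varx_def prime_elem_const_poly_iff by (rule prime_elem_linear_field_poly) simp
  show "\<not> varx dvd vary"
  proof
    assume "varx dvd vary"
    then obtain r where "vary = varx * r" ..
    then have "coeff3 vary 0 1 0 = 0" using coeff3_varx_mult[of r 0 1 0] by simp
    then show False using coeff3_mono3[of 0 1 0 0 1 0] by (simp add: mono3_def)
  qed
qed

text \<open>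
  The regularity of \<open>x^N\<close>, \<open>y^N\<close>, \<open>z^N\<close> in two steps: here \<open>y^N\<close> is a non-zero-divisor modulo \<open>x^N\<close>. In the
  lemma after it, \<open>z^N\<close> is one modulo \<open>x^N\<close> and \<open>y^N\<close>, since these two do not involve \<open>z\<close> and
  can be compared coefficient by coefficient in \<open>z\<close>.
\<close>

lemma varx_power_dvd_cancel:
  assumes "vary ^ N * p = varx ^ N * q"
  shows "varx ^ N dvd p"
proof -
  have "varx ^ N dvd vary ^ N * p" by (simp add: assms)
  moreover have "coprime (varx ^ N) (vary ^ N)" using coprime_varx_vary by simp
  ultimately show ?thesis by (simp add: coprime_dvd_mult_right_iff)
qed

lemma varz_power_regular:
  assumes "varz ^ N * w = vary ^ N * p - varx ^ N * q"
  shows "w = vary ^ N * poly_shift N p - varx ^ N * poly_shift N q"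
proof (rule poly_eqI)
  fix k
  define X :: "complex poly poly" where "X = [:[:0, 1:]:] ^ N"
  define Y :: "complex poly poly" where "Y = [:0, 1:] ^ N"
  have x: "varx ^ N = [:X:]" and y: "vary ^ N = [:Y:]" and z: "varz ^ N = monom 1 N"
    unfolding X_def Y_def varx_def vary_def varz_def
    by (simp_all add: poly_const_pow monom_altdef)
  have "coeff (varz ^ N * w) (k + N) = coeff (vary ^ N * p - varx ^ N * q) (k + N)"
    by (simp only: assms)
  then show "coeff w k = coeff (vary ^ N * poly_shift N p - varx ^ N * poly_shift N q) k"
    unfolding x y z by (simp add: coeff_poly_shift coeff_monom_mult)
qed

text \<open>
  The cokernel of \<open>A\<close> has projective dimension at most two, hence positive depth, so it has no
  nonzero element killed by powers of all three variables. The proof is the diagram chase through the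
  Koszul relations: lifts \<open>a, b, c\<close> of \<open>x^N v\<close>, \<open>y^N v\<close>, \<open>z^N v\<close> satisfy the Koszul relations up to the image of
  \<open>B\<close>, and regularity is used to correct \<open>a\<close> until \<open>x^N\<close> divides it.
\<close>

lemma mat_image_saturated:
  fixes A B :: "poly3 mat"
  assumes A: "A \<in> carrier_mat n p" and B: "B \<in> carrier_mat p q"
    and exact: "mat_kernel A = mat_image B" and inj: "mat_kernel B = {0\<^sub>v q}"
    and v: "v \<in> carrier_vec n"
    and im: "varx ^ N \<cdot>\<^sub>v v \<in> mat_image A" "vary ^ N \<cdot>\<^sub>v v \<in> mat_image A" "varz ^ N \<cdot>\<^sub>v v \<in> mat_image A"
  shows "v \<in> mat_image A"
proof -
  define X Y Z where "X = varx ^ N" and "Y = vary ^ N" and "Z = varz ^ N"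
  note XYZ = X_def Y_def Z_def
  obtain a where a: "a \<in> carrier_vec p" "X \<cdot>\<^sub>v v = A *\<^sub>v a" using im(1) A by (auto simp: XYZ elim: mat_imageE)
  obtain b where b: "b \<in> carrier_vec p" "Y \<cdot>\<^sub>v v = A *\<^sub>v b" using im(2) A by (auto simp: XYZ elim: mat_imageE)
  obtain c where c: "c \<in> carrier_vec p" "Z \<cdot>\<^sub>v v = A *\<^sub>v c" using im(3) A by (auto simp: XYZ elim: mat_imageE)
  have lift: "\<exists>w\<in>carrier_vec q. k \<cdot>\<^sub>v s - l \<cdot>\<^sub>v t = B *\<^sub>v w"
    if "s \<in> carrier_vec p" "l \<cdot>\<^sub>v v = A *\<^sub>v s" "t \<in> carrier_vec p" "k \<cdot>\<^sub>v v = A *\<^sub>v t" for k l s t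
  proof -
    have "A *\<^sub>v (k \<cdot>\<^sub>v s - l \<cdot>\<^sub>v t) = k \<cdot>\<^sub>v (l \<cdot>\<^sub>v v) - l \<cdot>\<^sub>v (k \<cdot>\<^sub>v v)"
      using that by (simp add: mult_mat_vec_lincomb[OF A])
    also have "\<dots> = 0\<^sub>v n"
      using v by (intro eq_vecI) auto
    finally have "k \<cdot>\<^sub>v s - l \<cdot>\<^sub>v t \<in> mat_kernel A"
      using that by (intro mat_kernelI[OF A]) auto
    then show ?thesis
      unfolding exact using B by (auto elim: mat_imageE)
  qed
  obtain wab where wab: "wab \<in> carrier_vec q" "Y \<cdot>\<^sub>v a - X \<cdot>\<^sub>v b = B *\<^sub>v wab" using lift[OF a b] by blast
  obtain wac where wac: "wac \<in> carrier_vec q" "Z \<cdot>\<^sub>v a - X \<cdot>\<^sub>v c = B *\<^sub>v wac" using lift[OF a c] by blast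
  obtain wbc where wbc: "wbc \<in> carrier_vec q" "Z \<cdot>\<^sub>v b - Y \<cdot>\<^sub>v c = B *\<^sub>v wbc" using lift[OF b c] by blast
  \<comment> \<open>The correction terms satisfy the second Koszul relation, because \<open>B\<close> is injective.\<close>
  have "B *\<^sub>v (Z \<cdot>\<^sub>v wab - 1 \<cdot>\<^sub>v (Y \<cdot>\<^sub>v wac - X \<cdot>\<^sub>v wbc))
      = Z \<cdot>\<^sub>v (B *\<^sub>v wab) - 1 \<cdot>\<^sub>v (Y \<cdot>\<^sub>v (B *\<^sub>v wac) - X \<cdot>\<^sub>v (B *\<^sub>v wbc))"
    using wab(1) wac(1) wbc(1) by (subst mult_mat_vec_lincomb[OF B]; simp add: mult_mat_vec_lincomb[OF B])
  also have "\<dots> = 0\<^sub>v p"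
    unfolding wab(2)[symmetric] wac(2)[symmetric] wbc(2)[symmetric]
    using a(1) b(1) c(1) by (intro eq_vecI) (auto simp: algebra_simps)
  finally have "Z \<cdot>\<^sub>v wab - 1 \<cdot>\<^sub>v (Y \<cdot>\<^sub>v wac - X \<cdot>\<^sub>v wbc) \<in> mat_kernel B"
    using wab wac wbc by (intro mat_kernelI[OF B]) auto
  then have w0: "Z \<cdot>\<^sub>v wab - 1 \<cdot>\<^sub>v (Y \<cdot>\<^sub>v wac - X \<cdot>\<^sub>v wbc) = 0\<^sub>v q" using inj by simp
  have wab_eq: "wab $ k = Y * poly_shift N (wac $ k) - X * poly_shift N (wbc $ k)" if "k < q" for k
  proof -
    have "(Z \<cdot>\<^sub>v wab - 1 \<cdot>\<^sub>v (Y \<cdot>\<^sub>v wac - X \<cdot>\<^sub>v wbc)) $ k = 0"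
      unfolding w0 using that by simp
    then have "Z * wab $ k = Y * wac $ k - X * wbc $ k"
      using wab(1) wac(1) wbc(1) that by auto
    then show ?thesis unfolding XYZ by (rule varz_power_regular)
  qed
  define r s where "r = vec q (\<lambda>k. poly_shift N (wac $ k))" and "s = vec q (\<lambda>k. poly_shift N (wbc $ k))"
  have rs: "r \<in> carrier_vec q" "s \<in> carrier_vec q" by (simp_all add: r_def s_def)
  have "wab = Y \<cdot>\<^sub>v r - X \<cdot>\<^sub>v s"
    using wab(1) by (intro eq_vecI) (auto simp: r_def s_def wab_eq)
  then have "Y \<cdot>\<^sub>v a - X \<cdot>\<^sub>v b = Y \<cdot>\<^sub>v (B *\<^sub>v r) - X \<cdot>\<^sub>v (B *\<^sub>v s)"
    using wab(2) rs by (simp add: mult_mat_vec_lincomb[OF B])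
  then have ab: "(Y \<cdot>\<^sub>v a - X \<cdot>\<^sub>v b) $ k = (Y \<cdot>\<^sub>v (B *\<^sub>v r) - X \<cdot>\<^sub>v (B *\<^sub>v s)) $ k" for k by simp
  have dvd: "X dvd a $ k - (B *\<^sub>v r) $ k" if "k < p" for k
  proof -
    have "Y * (a $ k - (B *\<^sub>v r) $ k) = X * (b $ k - (B *\<^sub>v s) $ k)"
      using ab[of k] that a(1) b(1) B by (simp add: algebra_simps)
    then show ?thesis unfolding XYZ by (rule varx_power_dvd_cancel)
  qed
  define t where "t = vec p (\<lambda>k. (a $ k - (B *\<^sub>v r) $ k) div X)"
  have t: "t \<in> carrier_vec p" by (simp add: t_def)
  have Br: "B *\<^sub>v r \<in> carrier_vec p" using B rs by simp
  have ABr: "A *\<^sub>v (B *\<^sub>v r) = 0\<^sub>v n"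
    using exact mat_imageI[OF B rs(1)] mat_kernelD[OF A] by blast
  have "1 \<cdot>\<^sub>v a - 1 \<cdot>\<^sub>v (B *\<^sub>v r) = X \<cdot>\<^sub>v t"
    using a(1) Br dvd B by (intro eq_vecI) (auto simp: t_def)
  then have "X \<cdot>\<^sub>v (A *\<^sub>v t) = A *\<^sub>v (1 \<cdot>\<^sub>v a - 1 \<cdot>\<^sub>v (B *\<^sub>v r))"
    by (simp add: mult_mat_vec_smult[OF A t])
  also have "\<dots> = 1 \<cdot>\<^sub>v (X \<cdot>\<^sub>v v) - 1 \<cdot>\<^sub>v 0\<^sub>v n"
    by (simp only: mult_mat_vec_lincomb[OF A a(1) Br] a(2) ABr)
  finally have eq: "(X \<cdot>\<^sub>v (A *\<^sub>v t)) $ k = (1 \<cdot>\<^sub>v (X \<cdot>\<^sub>v v) - 1 \<cdot>\<^sub>v 0\<^sub>v n) $ k" for k by simp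
  have "v = A *\<^sub>v t"
  proof (rule eq_vecI)
    show "dim_vec v = dim_vec (A *\<^sub>v t)" using v A by simp
    fix k assume "k < dim_vec (A *\<^sub>v t)"
    then have "X * (A *\<^sub>v t) $ k = X * v $ k" using eq[of k] v A by auto
    moreover have "X \<noteq> 0" by (simp add: X_def varx_def)
    ultimately show "v $ k = (A *\<^sub>v t) $ k" by simp
  qed
  then show ?thesis using mat_imageI[OF A t] by simp
qed

section \<open>Gradients and cross products\<close>

lemma ext_d_index [simp]: "ext_d p $ 0 = pdx p" "ext_d p $ Suc 0 = pdy p" "ext_d p $ 2 = pdz p"
  by (simp_all add: ext_d_def numeral_2_eq_2)

lemma wedge_index [simp]:
  "wedge u v $ 0 = u $ Suc 0 * v $ 2 - u $ 2 * v $ Suc 0"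
  "wedge u v $ Suc 0 = u $ 2 * v $ 0 - u $ 0 * v $ 2"
  "wedge u v $ 2 = u $ 0 * v $ Suc 0 - u $ Suc 0 * v $ 0"
  by (simp_all add: wedge_def numeral_2_eq_2)

lemma wedge_carrier [simp]: "wedge u v \<in> carrier_vec 3" "ext_d p \<in> carrier_vec 3"
  by (simp_all add: wedge_def ext_d_def carrier_dim_vec)

lemma less_3_cases: "r < 3 \<Longrightarrow> r = 0 \<or> r = Suc 0 \<or> r = (2::nat)"
  by auto

lemma vec3_eqI:
  assumes "u \<in> carrier_vec 3" "v \<in> carrier_vec 3"
    and "u $ 0 = v $ 0" "u $ Suc 0 = v $ Suc 0" "u $ 2 = v $ 2"
  shows "u = v"
  using assms by (intro eq_vecI) (auto dest!: less_3_cases)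

lemma ext_d_prod:
  assumes "finite A" "r < 3"
  shows "ext_d (\<Prod>k\<in>A. g k) $ r = (\<Sum>i\<in>A. (\<Prod>k\<in>A - {i}. g k) * ext_d (g i) $ r)"
  using assms(1) less_3_cases[OF assms(2)] by (auto simp: pd_prod)

lemma wedge_sum_left:
  assumes "\<And>r. r < 3 \<Longrightarrow> u $ r = (\<Sum>i\<in>A. c i * g i $ r)" "r < 3"
  shows "wedge u v $ r = (\<Sum>i\<in>A. c i * wedge (g i) v $ r)"
  using less_3_cases[OF assms(2)] assms(1)[of 0] assms(1)[of "Suc 0"] assms(1)[of 2]
  by (auto simp: sum_distrib_right sum_distrib_left sum_subtractf algebra_simps)

lemma prime_elem_dvd_prodD:
  assumes "prime_elem p" "finite A" "p dvd (\<Prod>k\<in>A. g k)"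
  shows "\<exists>k\<in>A. p dvd g k"
  using assms(2,3)
  by (induction) (use assms(1) in \<open>auto dest: prime_elem_dvd_multD simp: prime_elem_not_unit\<close>)

text \<open>
  In vectors: if \<open>p \<times> q = 0\<close>, then \<open>r \<cdot> q\<close> times \<open>p\<close> equals \<open>r \<cdot> p\<close> times \<open>q\<close>, the
  expansion of \<open>r \<times> (p \<times> q) = 0\<close>.
\<close>

lemma cross_zero_imp_proportional:
  fixes a b c u v w x y z :: "'a :: comm_ring"
  assumes "b * w = c * v" "c * u = a * w" "a * v = b * u"
  shows "(x * u + y * v + z * w) * a = u * (x * a + y * b + z * c)"
    and "(x * u + y * v + z * w) * b = v * (x * a + y * b + z * c)"
    and "(x * u + y * v + z * w) * c = w * (x * a + y * b + z * c)"
proof -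
  have "t * (b * w) = t * (c * v)" "t * (c * u) = t * (a * w)" "t * (a * v) = t * (b * u)" for t
    by (simp_all add: assms)
  from this[of x] this[of y] this[of z]
  show "(x * u + y * v + z * w) * a = u * (x * a + y * b + z * c)"
    and "(x * u + y * v + z * w) * b = v * (x * a + y * b + z * c)"
    and "(x * u + y * v + z * w) * c = w * (x * a + y * b + z * c)"
    by (simp_all add: algebra_simps)
qed

lemma cross_zero_imp_dependent:
  fixes a1 a2 a3 b1 b2 b3 :: "'a :: idom"
  assumes "a2 * b3 = a3 * b2" "a3 * b1 = a1 * b3" "a1 * b2 = a2 * b1"
  shows "\<exists>s t. (s, t) \<noteq> (0, 0) \<and> s * a1 + t * b1 = 0 \<and> s * a2 + t * b2 = 0 \<and> s * a3 + t * b3 = 0"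
proof -
  consider "a1 \<noteq> 0" | "a2 \<noteq> 0" | "a3 \<noteq> 0" | "a1 = 0" "a2 = 0" "a3 = 0" by blast
  then show ?thesis
  proof cases
    case 1
    then show ?thesis using assms by (intro exI[of _ "b1"] exI[of _ "- a1"]) (simp add: algebra_simps)
  next
    case 2
    then show ?thesis using assms by (intro exI[of _ "b2"] exI[of _ "- a2"]) (simp add: algebra_simps)
  next
    case 3
    then show ?thesis using assms by (intro exI[of _ "b3"] exI[of _ "- a3"]) (simp add: algebra_simps)
  next
    case 4
    then show ?thesis by (intro exI[of _ 1] exI[of _ 0]) simp
  qed
qed

text \<open>
  Three covectors that vanish on a common nonzero vector have determinant zero; a row of cofactors
  is then a dependence, unless the cofactors used are all zero, in which case two of the
  covectors are proportional already.
\<close>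

lemma common_zero_imp_dependent:
  fixes a1 a2 a3 b1 b2 b3 c1 c2 c3 x y z :: "'a :: idom"
  assumes xyz: "(x, y, z) \<noteq> (0, 0, 0)"
    and a: "x * a1 + y * a2 + z * a3 = 0"
    and b: "x * b1 + y * b2 + z * b3 = 0"
    and c: "x * c1 + y * c2 + z * c3 = 0"
  shows "\<exists>s t u. (s, t, u) \<noteq> (0, 0, 0) \<and> s * a1 + t * b1 + u * c1 = 0 \<and>
    s * a2 + t * b2 + u * c2 = 0 \<and> s * a3 + t * b3 + u * c3 = 0"
proof -
  define D where "D = a1 * (b2 * c3 - b3 * c2) + a2 * (b3 * c1 - b1 * c3) + a3 * (b1 * c2 - b2 * c1)"
  have "D * x = (b2 * c3 - b3 * c2) * (x * a1 + y * a2 + z * a3)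
      + (c2 * a3 - c3 * a2) * (x * b1 + y * b2 + z * b3) + (a2 * b3 - a3 * b2) * (x * c1 + y * c2 + z * c3)"
    by (simp add: D_def algebra_simps)
  moreover have "D * y = (b3 * c1 - b1 * c3) * (x * a1 + y * a2 + z * a3)
      + (c3 * a1 - c1 * a3) * (x * b1 + y * b2 + z * b3) + (a3 * b1 - a1 * b3) * (x * c1 + y * c2 + z * c3)"
    by (simp add: D_def algebra_simps)
  moreover have "D * z = (b1 * c2 - b2 * c1) * (x * a1 + y * a2 + z * a3)
      + (c1 * a2 - c2 * a1) * (x * b1 + y * b2 + z * b3) + (a1 * b2 - a2 * b1) * (x * c1 + y * c2 + z * c3)"
    by (simp add: D_def algebra_simps)
  ultimately have D: "D = 0" using xyz unfolding a b c by auto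
  consider "a2 * b3 - a3 * b2 \<noteq> 0" | "a3 * b1 - a1 * b3 \<noteq> 0" | "a1 * b2 - a2 * b1 \<noteq> 0"
    | "a2 * b3 = a3 * b2" "a3 * b1 = a1 * b3" "a1 * b2 = a2 * b1" by force
  then show ?thesis
  proof cases
    case 1
    then show ?thesis using D unfolding D_def
      by (intro exI[of _ "b2 * c3 - b3 * c2"] exI[of _ "c2 * a3 - c3 * a2"] exI[of _ "a2 * b3 - a3 * b2"])
        (simp add: algebra_simps)
  next
    case 2
    then show ?thesis using D unfolding D_def
      by (intro exI[of _ "b3 * c1 - b1 * c3"] exI[of _ "c3 * a1 - c1 * a3"] exI[of _ "a3 * b1 - a1 * b3"])
        (simp add: algebra_simps)
  next
    case 3
    then show ?thesis using D unfolding D_def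
      by (intro exI[of _ "b1 * c2 - b2 * c1"] exI[of _ "c1 * a2 - c2 * a1"] exI[of _ "a1 * b2 - a2 * b1"])
        (simp add: algebra_simps)
  next
    case 4
    from cross_zero_imp_dependent[OF this] obtain s t where
      "(s, t) \<noteq> (0, 0)" "s * a1 + t * b1 = 0" "s * a2 + t * b2 = 0" "s * a3 + t * b3 = 0" by blast
    then show ?thesis by (intro exI[of _ s] exI[of _ t] exI[of _ 0]) auto
  qed
qed

section \<open>Arrangements of curves containing two lines\<close>

locale two_line_arrangement =
  fixes m :: nat and f :: "nat \<Rightarrow> poly3" and e :: "nat \<Rightarrow> nat"
  assumes m_ge: "3 \<le> m"
    and irred: "j \<in> {1..m} \<Longrightarrow> irreducible (f j)"
    and homog: "j \<in> {1..m} \<Longrightarrow> homogeneous (int (e j)) (f j)"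
    and not_dvd: "i \<in> {1..m} \<Longrightarrow> j \<in> {1..m} \<Longrightarrow> i \<noteq> j \<Longrightarrow> \<not> f i dvd f j"
    and crossing: "normal_crossing {1..m} f"
    and f1: "f 1 = varx" and f2: "f 2 = vary"
    and e_ge_2: "j \<in> {3..m} \<Longrightarrow> 2 \<le> e j"
begin

text \<open>
  \<open>cof j\<close> and \<open>cof2 j i\<close> are \<open>F / f_j\<close> and \<open>F / (f_i f_j)\<close>; as products they do not require a division.
\<close>

definition F :: poly3 where "F = (\<Prod>k=1..m. f k)"
definition cof :: "nat \<Rightarrow> poly3" where "cof j = (\<Prod>k\<in>{1..m} - {j}. f k)"
definition cof2 :: "nat \<Rightarrow> nat \<Rightarrow> poly3" where "cof2 j i = (\<Prod>k\<in>{1..m} - {j} - {i}. f k)"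
definition d :: nat where "d = (\<Sum>j=1..m. e j)"

lemma f_nz: "j \<in> {1..m} \<Longrightarrow> f j \<noteq> 0"
  using irred by fastforce

lemma f_prime: "j \<in> {1..m} \<Longrightarrow> prime_elem (f j)"
  using irred irreducible_imp_prime_elem by blast

lemma e_lines: "e 1 = 1" "e 2 = 1"
  using homogeneous_line_degree(1)[OF homog[of 1, unfolded f1]]
    homogeneous_line_degree(2)[OF homog[of 2, unfolded f2]] m_ge by simp_all

lemma e_pos: "j \<in> {1..m} \<Longrightarrow> 1 \<le> e j"
proof -
  assume "j \<in> {1..m}"
  then have "j = 1 \<or> j = 2 \<or> j \<in> {3..m}" by auto
  then show ?thesis using e_lines e_ge_2[of j] by fastforce
qed

lemma d_pos: "0 < d"
  unfolding d_def using e_lines(1) m_ge by (intro sum_pos2[of _ 1]) auto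

lemma F_nz: "F \<noteq> 0"
  unfolding F_def using f_nz by simp

lemma F_eq: "j \<in> {1..m} \<Longrightarrow> F = f j * cof j"
  unfolding F_def cof_def by (rule prod.remove) auto

lemma cof_eq: "i \<in> {1..m} \<Longrightarrow> i \<noteq> j \<Longrightarrow> cof j = f i * cof2 j i"
  unfolding cof_def cof2_def by (rule prod.remove) auto

lemma F_homog: "homogeneous (int d) F"
  unfolding F_def d_def of_nat_sum by (rule homogeneous_prod) (rule homog)

lemma cof_homog: "j \<in> {1..m} \<Longrightarrow> homogeneous (int d - int (e j)) (cof j)"
  unfolding cof_def using homogeneous_prod[of "{1..m} - {j}" "\<lambda>j. int (e j)" f] homog
  by (simp add: d_def sum_diff)

lemma not_dvd_cof: "j \<in> {1..m} \<Longrightarrow> \<not> f j dvd cof j"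
  unfolding cof_def using f_prime[of j] not_dvd[of j] prime_elem_dvd_prodD[of "f j" "{1..m} - {j}" f] by auto

lemma euler_f: "j \<in> {1..m} \<Longrightarrow> varx * pdx (f j) + vary * pdy (f j) + varz * pdz (f j) = of_nat (e j) * f j"
  by (rule euler_identity[OF homog])

lemma euler_F: "varx * pdx F + vary * pdy F + varz * pdz F = of_nat d * F"
  by (rule euler_identity[OF F_homog])

lemma ext_d_F: "r < 3 \<Longrightarrow> ext_d F $ r = (\<Sum>i\<in>{1..m}. cof i * ext_d (f i) $ r)"
  unfolding F_def cof_def by (rule ext_d_prod) auto

lemma ext_d_cof: "r < 3 \<Longrightarrow> ext_d (cof j) $ r = (\<Sum>i\<in>{1..m} - {j}. cof2 j i * ext_d (f i) $ r)"
  unfolding cof2_def cof_def by (rule ext_d_prod) auto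

lemma ext_d_F_split:
  assumes "j \<in> {1..m}"
  shows "pdx F = f j * pdx (cof j) + cof j * pdx (f j)"
    "pdy F = f j * pdy (cof j) + cof j * pdy (f j)"
    "pdz F = f j * pdz (cof j) + cof j * pdz (f j)"
  by (simp_all add: F_eq[OF assms] pdx_mult pdy_mult pdz_mult)

text \<open>
  Differentiating the product \<open>cof j\<close> gives the defining sum of \<open>\<omega>_j\<close>, which thus is a single wedge
  product. Almost every computation below uses this form.
\<close>

lemma omega_eq_wedge:
  assumes j: "j \<in> {1..m}"
  shows "omega m f j = wedge (ext_d (cof j)) (ext_d (f j))"
proof (rule eq_vecI)
  show "dim_vec (omega m f j) = dim_vec (wedge (ext_d (cof j)) (ext_d (f j)))"
    by (simp add: omega_def wedge_def)
  fix r assume "r < dim_vec (wedge (ext_d (cof j)) (ext_d (f j)))"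
  then have r: "r < 3" by (simp add: wedge_def)
  have "(\<Prod>k=1..m. f k) div (f i * f j) = cof2 j i" if "i \<in> {1..m} - {j}" for i
  proof -
    have "(\<Prod>k=1..m. f k) = (f i * f j) * cof2 j i"
      using F_eq[OF j] cof_eq[of i j] that by (simp add: F_def algebra_simps)
    then show ?thesis
      using f_nz[OF j] f_nz[of i] that by simp
  qed
  then show "omega m f j $ r = wedge (ext_d (cof j)) (ext_d (f j)) $ r"
    using r by (simp add: omega_def wedge_sum_left[OF ext_d_cof])
qed

lemma omega_carrier [simp]: "omega m f j \<in> carrier_vec 3"
  by (simp add: omega_def)

lemma omega_z_carrier [simp]: "omega_z F \<in> carrier_vec 3"
  by (simp add: omega_z_def)

lemma dim_omega [simp]:
  "dim_vec (wedge u v) = 3" "dim_vec (omega m f i) = 3" "dim_vec (omega_z F) = 3"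
  by (simp_all add: wedge_def omega_def omega_z_def)

lemma f_mult_omega:
  assumes "j \<in> {1..m}" "r < 3"
  shows "f j * omega m f j $ r = wedge (ext_d F) (ext_d (f j)) $ r"
  unfolding omega_eq_wedge[OF assms(1)] using less_3_cases[OF assms(2)] ext_d_F_split[OF assms(1)]
  by (auto simp: algebra_simps)

lemma x_omega_1: "r < 3 \<Longrightarrow> varx * omega m f 1 $ r = wedge (ext_d F) (ext_d varx) $ r"
  and y_omega_2: "r < 3 \<Longrightarrow> vary * omega m f 2 $ r = wedge (ext_d F) (ext_d vary) $ r"
  using f_mult_omega[of 1 r] f_mult_omega[of 2 r] m_ge unfolding f1 f2 by simp_all

text \<open>
  After multiplication by \<open>F\<close> the sum is \<open>dF \<and> dF\<close>.
\<close>

lemma sum_omega: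
  assumes r: "r < 3"
  shows "(\<Sum>j=1..m. omega m f j $ r) = 0"
proof -
  have "F * (\<Sum>j=1..m. omega m f j $ r) = (\<Sum>j=1..m. cof j * wedge (ext_d F) (ext_d (f j)) $ r)"
    unfolding sum_distrib_left
  proof (intro sum.cong refl)
    fix j assume j: "j \<in> {1..m}"
    have "F * omega m f j $ r = cof j * (f j * omega m f j $ r)"
      by (simp add: F_eq[OF j])
    then show "F * omega m f j $ r = cof j * wedge (ext_d F) (ext_d (f j)) $ r"
      by (simp only: f_mult_omega[OF j r])
  qed
  also have "\<dots> = - (\<Sum>j=1..m. cof j * wedge (ext_d (f j)) (ext_d F) $ r)"
    unfolding sum_negf[symmetric]
    using less_3_cases[OF r] by (intro sum.cong refl) (auto simp: algebra_simps)
  also have "\<dots> = - wedge (ext_d F) (ext_d F) $ r"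
    by (simp only: wedge_sum_left[OF ext_d_F r])
  also have "\<dots> = 0" using less_3_cases[OF r] by auto
  finally show ?thesis using F_nz by simp
qed

lemma omega_subst_eq:
  assumes "j \<in> {1..m}"
  shows "omega_subst m f j = omega m f j"
proof (cases "j = m")
  case True
  have "- (\<Sum>i=1..m-1. omega m f i $ r) = omega m f m $ r" if "r < 3" for r
  proof -
    have "{1..m} = insert m {1..m-1}" using m_ge by auto
    then have "omega m f m $ r + (\<Sum>i=1..m-1. omega m f i $ r) = 0"
      using sum_omega[OF that] m_ge by simp
    then show ?thesis by (simp add: eq_neg_iff_add_eq_0[symmetric])
  qed
  then show ?thesis
    using True by (intro eq_vecI) (auto simp: omega_subst_def omega_def)
qed (simp add: omega_subst_def)

lemma rho_relation:
  assumes j: "j \<in> {1..m}"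
  shows "f j \<cdot>\<^sub>v omega m f j - ((varx * pdx (f j)) \<cdot>\<^sub>v omega m f 1 + (vary * pdy (f j)) \<cdot>\<^sub>v omega m f 2 +
      pdz (f j) \<cdot>\<^sub>v omega_z F) = 0\<^sub>v 3" (is "?v = _")
proof (rule eq_vecI)
  show "dim_vec ?v = dim_vec (0\<^sub>v 3)" by (simp add: omega_z_def wedge_def)
  fix r assume "r < dim_vec (0\<^sub>v 3 :: poly3 vec)"
  then have r: "r < 3" by simp
  have "?v $ r = f j * omega m f j $ r - (pdx (f j) * (varx * omega m f 1 $ r)
      + pdy (f j) * (vary * omega m f 2 $ r) + pdz (f j) * omega_z F $ r)"
    using r by (simp add: omega_def omega_z_def wedge_def algebra_simps)
  also have "\<dots> = 0"
    unfolding x_omega_1[OF r] y_omega_2[OF r] f_mult_omega[OF j r] omega_z_def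
    using less_3_cases[OF r] by (auto simp: algebra_simps)
  finally show "?v $ r = 0\<^sub>v 3 $ r" using r by simp
qed

section \<open>The two matrices\<close>

text \<open>
  \<open>A\<close> is the map of the generators and \<open>B\<close> the map of their relations. In a vector of length \<open>m\<close> the
  coordinate with index \<open>i - 1\<close> belongs to \<open>\<omega>_i\<close>, for \<open>1 \<le> i < m\<close>, and the last one to \<open>\<omega>^z\<close>; in a vector of
  length \<open>m - 2\<close> the coordinate with index \<open>j - 3\<close> belongs to \<open>\<rho>_j\<close>.
\<close>

abbreviation A where "A \<equiv> omega_matrix m f"
abbreviation B where "B \<equiv> rho_matrix m f"

lemma A_carrier: "A \<in> carrier_mat 3 m"
  using m_ge by (auto simp: omega_matrix_def)

lemma B_carrier: "B \<in> carrier_mat m (m - 2)"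
  by (auto simp: rho_matrix_def)

lemma col_A: "k < m - 1 \<Longrightarrow> col A k = omega m f (Suc k)" "col A (m - 1) = omega_z F"
  using m_ge omega_z_carrier by (simp_all add: omega_matrix_def nth_append F_def)

lemma rho_carrier: "rho m f j \<in> carrier_vec m"
  by (simp add: rho_def omega_coord_def omega_z_coord_def)

lemma col_B: "l < m - 2 \<Longrightarrow> col B l = rho m f (l + 3)"
  using rho_carrier by (simp add: rho_matrix_def add.commute del: upt_Suc)

lemma A_mult_index:
  assumes v: "v \<in> carrier_vec m" and r: "r < 3"
  shows "(A *\<^sub>v v) $ r = (\<Sum>i=1..m-1. v $ (i - 1) * omega m f i $ r) + v $ (m - 1) * omega_z F $ r"
proof -
  have entry: "A $$ (r, k) = col A k $ r" if "k < m" for k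
    using that r A_carrier by simp
  have "(A *\<^sub>v v) $ r = (\<Sum>k = 0..<m. A $$ (r, k) * v $ k)"
    using v r A_carrier by (simp add: scalar_prod_def)
  also have "\<dots> = (\<Sum>k = 0..<m-1. A $$ (r, k) * v $ k) + A $$ (r, m-1) * v $ (m-1)"
    using m_ge by (cases m) auto
  also have "(\<Sum>k = 0..<m-1. A $$ (r, k) * v $ k) = (\<Sum>k = 0..<m-1. v $ k * omega m f (Suc k) $ r)"
    by (intro sum.cong refl) (simp add: entry col_A)
  also have "\<dots> = (\<Sum>i=1..m-1. v $ (i - 1) * omega m f i $ r)"
    by (rule sum.reindex_bij_witness[of _ "\<lambda>i. i - 1" Suc]) auto
  also have "A $$ (r, m-1) = omega_z F $ r"
    using m_ge col_A(2) entry[of "m - 1"] by simp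
  finally show ?thesis by (simp add: mult.commute)
qed

lemma B_mult_index:
  assumes q: "q \<in> carrier_vec (m - 2)" and k: "k < m"
  shows "(B *\<^sub>v q) $ k = (\<Sum>j=3..m. q $ (j - 3) * rho m f j $ k)"
proof -
  have "(B *\<^sub>v q) $ k = (\<Sum>l = 0..<m-2. B $$ (k, l) * q $ l)"
    using q k B_carrier by (simp add: scalar_prod_def)
  also have "\<dots> = (\<Sum>l = 0..<m-2. q $ l * rho m f (l + 3) $ k)"
  proof (intro sum.cong refl)
    fix l assume "l \<in> {0..<m-2}"
    then have "B $$ (k, l) = col B l $ k" "l < m - 2" using k B_carrier by auto
    then show "B $$ (k, l) * q $ l = q $ l * rho m f (l + 3) $ k" by (simp add: col_B mult.commute)
  qed
  also have "\<dots> = (\<Sum>j=3..m. q $ (j - 3) * rho m f j $ k)"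
    using m_ge by (intro sum.reindex_bij_witness[of _ "\<lambda>j. j - 3" "\<lambda>l. l + 3"]) auto
  finally show ?thesis .
qed

lemma rho_index:
  assumes "j \<in> {3..m}" "k < m"
  shows "rho m f j $ k = (if j = Suc k \<and> j < m then f (Suc k) else 0)
     - (if j = m then (if k < m - 1 then f m else 0) else 0)
     - (if k = 0 then varx * pdx (f j) else 0) - (if k = 1 then vary * pdy (f j) else 0)
     - (if k = m - 1 then pdz (f j) else 0)"
  using assms m_ge by (auto simp: rho_def omega_coord_def omega_z_coord_def unit_vec_def)

text \<open>
  The negative term with \<open>Q m * f m\<close> in all but the last coordinate comes from \<open>\<omega>_m\<close> being expressed
  as minus the sum of the other forms.
\<close>

lemma sum_rho_index:
  assumes k: "k < m"
  shows "(\<Sum>j=3..m. Q j * rho m f j $ k) = (if 2 \<le> k \<and> k < m - 1 then Q (Suc k) * f (Suc k) else 0)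
     - (if k < m - 1 then Q m * f m else 0)
     - (if k = 0 then varx * (\<Sum>j=3..m. Q j * pdx (f j)) else 0)
     - (if k = 1 then vary * (\<Sum>j=3..m. Q j * pdy (f j)) else 0)
     - (if k = m - 1 then (\<Sum>j=3..m. Q j * pdz (f j)) else 0)"
proof -
  have "(\<Sum>j=3..m. Q j * rho m f j $ k) = (\<Sum>j=3..m. if j = Suc k then (if Suc k < m then Q (Suc k) * f (Suc k) else 0) else 0)
     - (\<Sum>j=3..m. if j = m then (if k < m - 1 then Q m * f m else 0) else 0)
     - (\<Sum>j=3..m. if k = 0 then varx * (Q j * pdx (f j)) else 0)
     - (\<Sum>j=3..m. if k = 1 then vary * (Q j * pdy (f j)) else 0)
     - (\<Sum>j=3..m. if k = m - 1 then Q j * pdz (f j) else 0)"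
    unfolding sum_subtractf[symmetric]
    by (intro sum.cong refl) (use k in \<open>auto simp: rho_index algebra_simps\<close>)
  then show ?thesis
    using m_ge by (auto simp: sum_distrib_left sum.delta')
qed

lemma coord_carrier [simp]:
  "omega_coord m i \<in> carrier_vec m" "omega_z_coord m \<in> carrier_vec m"
  by (simp_all add: omega_coord_def omega_z_coord_def)

lemma A_unit_vec: "k < m \<Longrightarrow> A *\<^sub>v unit_vec m k = col A k"
  using A_carrier by (intro eq_vecI) auto

lemma A_omega_z_coord: "A *\<^sub>v omega_z_coord m = omega_z F"
  using A_unit_vec[of "m - 1"] col_A(2) m_ge by (simp add: omega_z_coord_def)

lemma A_omega_coord:
  assumes i: "i \<in> {1..m}"
  shows "A *\<^sub>v omega_coord m i = omega m f i"
proof (cases "i = m")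
  case False
  then have "i - 1 < m - 1" "i - 1 < m" "Suc (i - 1) = i" using i by auto
  then show ?thesis
    using A_unit_vec[of "i - 1"] col_A(1)[of "i - 1"] False by (simp add: omega_coord_def)
next
  case True
  show ?thesis
  proof (rule eq_vecI)
    show "dim_vec (A *\<^sub>v omega_coord m i) = dim_vec (omega m f i)"
      using A_carrier by (simp add: omega_def)
    fix r assume "r < dim_vec (omega m f i)"
    then have r: "r < 3" by (simp add: omega_def)
    have "(A *\<^sub>v omega_coord m i) $ r = - (\<Sum>i=1..m-1. omega m f i $ r)"
      using m_ge True
      by (subst A_mult_index[OF _ r]) (auto simp: omega_coord_def sum_negf[symmetric] intro!: sum.cong)
    also have "\<dots> = omega_subst m f m $ r" using r by (simp add: omega_subst_def)
    finally show "(A *\<^sub>v omega_coord m i) $ r = omega m f i $ r"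
      using omega_subst_eq[of m] m_ge True by simp
  qed
qed

lemma A_rho:
  assumes j: "j \<in> {3..m}"
  shows "A *\<^sub>v rho m f j = 0\<^sub>v 3"
proof -
  have "A *\<^sub>v rho m f j = f j \<cdot>\<^sub>v omega m f j -
     ((varx * pdx (f j)) \<cdot>\<^sub>v omega m f 1 + (vary * pdy (f j)) \<cdot>\<^sub>v omega m f 2 + pdz (f j) \<cdot>\<^sub>v omega_z F)"
    unfolding rho_def using j m_ge
    by (simp add: mult_minus_distrib_mat_vec[OF A_carrier] mult_add_distrib_mat_vec[OF A_carrier]
        mult_mat_vec_smult[OF A_carrier] A_omega_coord A_omega_z_coord)
  also have "\<dots> = 0\<^sub>v 3" using rho_relation[of j] j by simp
  finally show ?thesis .
qed

lemma A_B: "q \<in> carrier_vec (m - 2) \<Longrightarrow> A *\<^sub>v (B *\<^sub>v q) = 0\<^sub>v 3"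
proof -
  assume q: "q \<in> carrier_vec (m - 2)"
  have "A * B = 0\<^sub>m 3 (m - 2)"
  proof (rule eq_matI)
    fix r l assume rl: "r < dim_row (0\<^sub>m 3 (m - 2) :: poly3 mat)" "l < dim_col (0\<^sub>m 3 (m - 2) :: poly3 mat)"
    then have "(A * B) $$ (r, l) = (A *\<^sub>v col B l) $ r" using A_carrier B_carrier by simp
    also have "\<dots> = 0" using rl A_rho[of "l + 3"] by (simp add: col_B)
    finally show "(A * B) $$ (r, l) = 0\<^sub>m 3 (m - 2) $$ (r, l)" using rl by simp
  qed (use A_carrier B_carrier in auto)
  then have "(A * B) *\<^sub>v q = 0\<^sub>v 3" using q by (intro eq_vecI) auto
  then show ?thesis using assoc_mult_mat_vec[OF A_carrier B_carrier q] by simp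
qed

section \<open>Exactness at the relations and at the generators\<close>

lemma sum_split_lines: "(\<Sum>j=1..m. g j) = g 1 + g 2 + (\<Sum>j=3..m. g j)"
proof -
  have "{1..m} = {1, 2} \<union> {3..m}" using m_ge by auto
  then show ?thesis by (simp add: sum.union_disjoint add.assoc)
qed

text \<open>
  If \<open>\<Sum> Q_j \<rho>_j = 0\<close>, then all \<open>Q_j f_j\<close> agree with one polynomial \<open>g\<close>. Contracting
  \<open>\<Sum> Q_j df_j\<close> with the Euler vector field gives \<open>(e_3 + ... + e_m) g = - 2 g\<close>, so \<open>g = 0\<close>.
\<close>

lemma kernel_B: "mat_kernel B = {0\<^sub>v (m - 2)}"
proof
  show "{0\<^sub>v (m - 2)} \<subseteq> mat_kernel B"
    using B_carrier by (auto intro!: mat_kernelI[OF B_carrier])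
  show "mat_kernel B \<subseteq> {0\<^sub>v (m - 2)}"
  proof
    fix q assume "q \<in> mat_kernel B"
    then have q: "q \<in> carrier_vec (m - 2)" and Bq: "B *\<^sub>v q = 0\<^sub>v m"
      using mat_kernelD[OF B_carrier] by blast+
    define Q where "Q j = q $ (j - 3)" for j
    define g where "g = Q m * f m"
    have rel: "(\<Sum>j=3..m. Q j * rho m f j $ k) = 0" if "k < m" for k
      using B_mult_index[OF q that] Bq that by (simp add: Q_def)
    have Qf: "Q j * f j = g" if j: "j \<in> {3..m}" for j
    proof (cases "j = m")
      case False
      then obtain k where k: "j = Suc k" "2 \<le> k" "k < m - 1" using j False by (cases j) auto
      then have "k < m" by simp
      from rel[OF this, unfolded sum_rho_index[OF this]] show ?thesis
        using k by (simp add: g_def)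
    qed (simp add: g_def)
    have x: "varx * (\<Sum>j=3..m. Q j * pdx (f j)) = - g"
      using rel[of 0] sum_rho_index[of 0 Q] m_ge by (auto simp: g_def algebra_simps)
    have two: "Suc 0 < m - Suc 0" using m_ge by simp
    then have y: "vary * (\<Sum>j=3..m. Q j * pdy (f j)) = - g"
      using rel[of 1] sum_rho_index[of 1 Q] m_ge by (auto simp: g_def algebra_simps)
    have z: "(\<Sum>j=3..m. Q j * pdz (f j)) = 0"
      using rel[of "m - 1"] sum_rho_index[of "m - 1" Q] m_ge two by auto
    have "(\<Sum>j=3..m. of_nat (e j)) * g = (\<Sum>j=3..m. Q j * (of_nat (e j) * f j))"
      unfolding sum_distrib_right by (intro sum.cong refl) (simp add: Qf[symmetric])
    also have "\<dots> = (\<Sum>j=3..m. Q j * (varx * pdx (f j) + vary * pdy (f j) + varz * pdz (f j)))"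
      by (intro sum.cong refl) (simp add: euler_f)
    also have "\<dots> = varx * (\<Sum>j=3..m. Q j * pdx (f j)) + vary * (\<Sum>j=3..m. Q j * pdy (f j))
        + varz * (\<Sum>j=3..m. Q j * pdz (f j))"
      by (simp add: sum_distrib_left sum.distrib algebra_simps)
    also have "\<dots> = - (2 * g)" unfolding x y z by simp
    finally have "of_nat (2 + (\<Sum>j=3..m. e j)) * g = 0"
      by (simp add: algebra_simps)
    then have "g = 0"
      unfolding mult_eq_0_iff of_nat_eq_0_iff by simp
    then have "Q j = 0" if "j \<in> {3..m}" for j
      using Qf[OF that] f_nz[of j] that by simp
    then have "q $ l = 0" if "l < m - 2" for l
      using that by (force simp: Q_def dest: spec[of _ "l + 3"])
    then show "q \<in> {0\<^sub>v (m - 2)}" using q by (auto intro!: eq_vecI)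
  qed
qed

text \<open>
  The relations among the generators. The 1-form \<open>eta\<close> below is the one whose wedge product
  with \<open>dF\<close> is \<open>F\<close> times the given relation; it is shown to be \<open>g dF\<close>, and
  then each \<open>V_j - g\<close> is divisible by \<open>f_j\<close>.
\<close>

lemma kernel_A: "mat_kernel A = mat_image B"
proof
  show "mat_image B \<subseteq> mat_kernel A"
    using A_B B_carrier by (auto elim!: mat_imageE intro!: mat_kernelI[OF A_carrier])
  show "mat_kernel A \<subseteq> mat_image B"
  proof
    fix v assume "v \<in> mat_kernel A"
    then have v: "v \<in> carrier_vec m" and Av: "A *\<^sub>v v = 0\<^sub>v 3"
      using mat_kernelD[OF A_carrier] by blast+
    \<comment> \<open>The coefficient of \<open>\<omega>_m\<close> is zero, which makes the relation symmetric in all components.\<close>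
    define V where "V i = (if i < m then v $ (i - 1) else 0)" for i
    define vz where "vz = v $ (m - 1)"
    define eta where "eta r = (\<Sum>i=1..m. V i * cof i * ext_d (f i) $ r) + F * vz * ext_d varz $ r" for r
    have rel: "(\<Sum>i=1..m. V i * omega m f i $ r) + vz * omega_z F $ r = 0" if r: "r < 3" for r
    proof -
      have "{1..m} = insert m {1..m-1}" using m_ge by auto
      then have "(\<Sum>i=1..m. V i * omega m f i $ r) = (\<Sum>i=1..m-1. V i * omega m f i $ r)"
        using m_ge by (simp add: V_def)
      also have "\<dots> = (\<Sum>i=1..m-1. v $ (i - 1) * omega m f i $ r)"
        using m_ge by (intro sum.cong refl) (auto simp: V_def)
      finally show ?thesis
        using A_mult_index[OF v r] Av r by (simp add: vz_def)
    qed
    have Fw: "F * omega m f i $ r = cof i * wedge (ext_d F) (ext_d (f i)) $ r"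
      if "i \<in> {1..m}" "r < 3" for i r
      using F_eq[OF that(1)] f_mult_omega[OF that] by (metis mult.assoc mult.commute)
    have parallel: "wedge (ext_d F) (vec 3 eta) $ r = 0" if r: "r < 3" for r
    proof -
      have "wedge (ext_d F) (vec 3 eta) $ r
          = (\<Sum>i=1..m. V i * (cof i * wedge (ext_d F) (ext_d (f i)) $ r)) + F * vz * omega_z F $ r"
        using less_3_cases[OF r]
        by (auto simp: eta_def omega_z_def sum_distrib_left sum_subtractf algebra_simps)
      also have "\<dots> = (\<Sum>i=1..m. V i * (F * omega m f i $ r)) + F * vz * omega_z F $ r"
        using Fw r by simp
      also have "\<dots> = F * ((\<Sum>i=1..m. V i * omega m f i $ r) + vz * omega_z F $ r)"
        by (simp add: sum_distrib_left algebra_simps)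
      finally show ?thesis using rel[OF r] by simp
    qed
    define G where "G = (\<Sum>i=1..m. of_nat (e i) * V i) + varz * vz"
    have "varx * eta 0 + vary * eta 1 + varz * eta 2
        = (\<Sum>i=1..m. V i * cof i * (varx * pdx (f i) + vary * pdy (f i) + varz * pdz (f i))) + F * vz * varz"
      by (simp add: eta_def sum_distrib_left sum.distrib algebra_simps)
    also have "\<dots> = (\<Sum>i=1..m. F * (of_nat (e i) * V i)) + F * vz * varz"
      by (intro arg_cong2[of _ _ _ _ "(+)"] sum.cong refl) (simp add: euler_f F_eq)
    finally have E: "varx * eta 0 + vary * eta 1 + varz * eta 2 = F * G"
      by (simp add: G_def sum_distrib_left algebra_simps)
    define g where "g = const3 (1 / of_nat d) * G"
    have dg: "of_nat d * g = G"
      using d_pos by (simp add: g_def const3_of_nat[symmetric] mult.assoc[symmetric] const3_mult[symmetric])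
    have eta: "eta r = g * ext_d F $ r" if r: "r < 3" for r
    proof -
      have p: "pdy F * eta 2 = pdz F * eta 1" "pdz F * eta 0 = pdx F * eta 2" "pdx F * eta 1 = pdy F * eta 0"
        using parallel[of 0] parallel[of 1] parallel[of 2] by simp_all
      have "(varx * eta 0 + vary * eta 1 + varz * eta 2) * pdx F = eta 0 * (varx * pdx F + vary * pdy F + varz * pdz F)"
        by (rule cross_zero_imp_proportional(1)[OF p])
      moreover have "(varx * eta 0 + vary * eta 1 + varz * eta 2) * pdy F = eta 1 * (varx * pdx F + vary * pdy F + varz * pdz F)"
        by (rule cross_zero_imp_proportional(2)[OF p])
      moreover have "(varx * eta 0 + vary * eta 1 + varz * eta 2) * pdz F = eta 2 * (varx * pdx F + vary * pdy F + varz * pdz F)"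
        by (rule cross_zero_imp_proportional(3)[OF p])
      ultimately have "F * G * ext_d F $ r = eta r * (varx * pdx F + vary * pdy F + varz * pdz F)"
        unfolding E using less_3_cases[OF r] by auto
      then have "(F * of_nat d) * (g * ext_d F $ r) = (F * of_nat d) * eta r"
        unfolding euler_F dg[symmetric] by (simp add: algebra_simps)
      then show ?thesis using F_nz d_pos by simp
    qed
    define W where "W i = V i - g" for i
    have W: "(\<Sum>i=1..m. W i * cof i * ext_d (f i) $ r) + F * vz * ext_d varz $ r = 0" if r: "r < 3" for r
      using eta[OF r] unfolding ext_d_F[OF r] W_def eta_def
      by (simp add: sum_distrib_left sum_subtractf algebra_simps)
    \<comment> \<open>Otherwise the prime \<open>f j\<close> divides its own partial derivatives. By degree these are zero,
        contradicting Euler's formula.\<close>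
    have dvdW: "f j dvd W j" if j: "j \<in> {1..m}" for j
    proof (rule ccontr)
      assume nW: "\<not> f j dvd W j"
      have "ext_d (f j) $ r = 0" if r: "r < 3" for r
      proof (rule ccontr)
        assume nz: "ext_d (f j) $ r \<noteq> 0"
        have "(\<Sum>i=1..m. W i * cof i * ext_d (f i) $ r)
            = W j * cof j * ext_d (f j) $ r + (\<Sum>i\<in>{1..m} - {j}. W i * cof i * ext_d (f i) $ r)"
          using j by (intro sum.remove) auto
        then have eq: "W j * cof j * ext_d (f j) $ r
            = - ((\<Sum>i\<in>{1..m} - {j}. W i * cof i * ext_d (f i) $ r) + F * vz * ext_d varz $ r)"
          using W[OF r] by (simp only: eq_neg_iff_add_eq_0 add.assoc)
        have "f j dvd (\<Sum>i\<in>{1..m} - {j}. W i * cof i * ext_d (f i) $ r)"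
          using j by (intro dvd_sum) (auto simp: cof_eq)
        moreover have "f j dvd F * vz * ext_d varz $ r"
          by (simp add: F_eq[OF j])
        ultimately have "f j dvd W j * cof j * ext_d (f j) $ r"
          unfolding eq by simp
        then have "f j dvd ext_d (f j) $ r"
          using nW not_dvd_cof[OF j] f_prime[OF j] by (simp add: prime_elem_dvd_mult_iff)
        moreover have "\<not> f j dvd ext_d (f j) $ r"
          using homogeneous_not_dvd[OF homog[OF j] _ _ nz, of "int (e j) - 1"]
            homogeneous_pd[OF homog[OF j]] less_3_cases[OF r] by auto
        ultimately show False by simp
      qed
      from this[of 0] this[of 1] this[of 2] have "of_nat (e j) * f j = 0"
        using euler_f[OF j] by simp
      then show False
        using e_pos[OF j] f_nz[OF j] by simp
    qed
    define Q where "Q j = W j div f j" for j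
    have WQ: "W j = f j * Q j" if "j \<in> {1..m}" for j
      using dvdW[OF that] by (simp add: Q_def)
    have Q: "(\<Sum>i=1..m. Q i * ext_d (f i) $ r) + vz * ext_d varz $ r = 0" if r: "r < 3" for r
    proof -
      have "(\<Sum>i=1..m. W i * cof i * ext_d (f i) $ r) = (\<Sum>i=1..m. F * (Q i * ext_d (f i) $ r))"
        by (intro sum.cong refl) (simp add: WQ F_eq)
      then have "F * ((\<Sum>i=1..m. Q i * ext_d (f i) $ r) + vz * ext_d varz $ r) = 0"
        using W[OF r] by (simp add: sum_distrib_left algebra_simps)
      then show ?thesis using F_nz by simp
    qed
    have Qx: "(\<Sum>j=3..m. Q j * pdx (f j)) = - Q 1"
      using Q[of 0] unfolding sum_split_lines f1 f2 by (simp add: eq_neg_iff_add_eq_0 add.commute)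
    have Qy: "(\<Sum>j=3..m. Q j * pdy (f j)) = - Q 2"
      using Q[of 1] unfolding sum_split_lines f1 f2 by (simp add: eq_neg_iff_add_eq_0 add.commute)
    have Qz: "(\<Sum>j=3..m. Q j * pdz (f j)) = - vz"
      using Q[of 2] unfolding sum_split_lines f1 f2 by (simp add: eq_neg_iff_add_eq_0)
    have Vm: "V i = f i * Q i - f m * Q m" if "i \<in> {1..m}" for i
    proof -
      have "V i = f i * Q i - (- g)" using WQ[OF that] by (simp add: W_def algebra_simps)
      also have "- g = f m * Q m" using WQ[of m] m_ge by (simp add: W_def V_def)
      finally show ?thesis .
    qed
    define q where "q = vec (m - 2) (\<lambda>l. Q (l + 3))"
    have q: "q \<in> carrier_vec (m - 2)" by (simp add: q_def)
    have "v = B *\<^sub>v q"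
    proof (rule eq_vecI)
      show "dim_vec v = dim_vec (B *\<^sub>v q)" using v B_carrier by simp
      fix k assume "k < dim_vec (B *\<^sub>v q)"
      then have k: "k < m" using B_carrier by simp
      have "(B *\<^sub>v q) $ k = (\<Sum>j=3..m. Q j * rho m f j $ k)"
        unfolding B_mult_index[OF q k] by (intro sum.cong refl) (auto simp: q_def)
      also have "\<dots> = v $ k"
      proof (cases "k = m - 1")
        case True
        then show ?thesis using k m_ge by (simp add: sum_rho_index Qz vz_def)
      next
        case False
        then have "Suc k < m" using k by simp
        then have "v $ k = f (Suc k) * Q (Suc k) - f m * Q m"
          using Vm[of "Suc k"] by (simp add: V_def)
        moreover have "k = 0 \<or> k = 1 \<or> 2 \<le> k" by auto
        ultimately show ?thesis
          using k False f1 f2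
          by (auto simp: sum_rho_index Qx Qy algebra_simps numeral_2_eq_2)
      qed
      finally show "v $ k = (B *\<^sub>v q) $ k" by simp
    qed
    then show "v \<in> mat_image B" using mat_imageI[OF B_carrier q] by simp
  qed
qed

section \<open>Generation of the syzygy module\<close>

text \<open>
  Polynomials that multiply every syzygy into the image of \<open>A\<close>.
\<close>

definition annihilators :: "poly3 set" where
  "annihilators = {ext_d F $ r | r. r < 3} \<union> {omega m f i $ r | i r. i \<in> {1..m} \<and> r < 3}"

lemma wedge_homog:
  assumes p: "homogeneous n p" and q: "homogeneous k q" and r: "r < 3"
  shows "homogeneous (n + k - 2) (wedge (ext_d p) (ext_d q) $ r)"
proof -
  have eq: "n + k - 2 = (n - 1) + (k - 1)" by simp
  have "homogeneous (n + k - 2) (a * b)" if "homogeneous (n - 1) a" "homogeneous (k - 1) b" for a b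
    unfolding eq by (rule homogeneous_mult[OF that])
  then show ?thesis
    using less_3_cases[OF r] homogeneous_pd[OF p] homogeneous_pd[OF q]
    by (auto intro!: homogeneous_diff)
qed

lemma omega_homog: "i \<in> {1..m} \<Longrightarrow> r < 3 \<Longrightarrow> homogeneous (int d - 2) (omega m f i $ r)"
  using wedge_homog[OF cof_homog homog, of i i r] by (simp add: omega_eq_wedge)

lemma omega_z_homog: "r < 3 \<Longrightarrow> homogeneous (int d - 1) (omega_z F $ r)"
  using wedge_homog[OF F_homog homogeneous_var(3), of r] by (simp add: omega_z_def)

lemma ext_d_F_homog: "r < 3 \<Longrightarrow> homogeneous (int d - 1) (ext_d F $ r)"
  using homogeneous_pd[OF F_homog] by (auto dest!: less_3_cases)

lemma d_ge_4: "4 \<le> d"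
proof -
  have "e 3 \<le> (\<Sum>j=3..m. e j)"
    using m_ge by (intro member_le_sum) auto
  then show ?thesis
    using e_ge_2[of 3] e_lines m_ge unfolding d_def sum_split_lines by simp
qed

lemma homogeneous_annihilator:
  assumes "g \<in> annihilators"
  shows "\<exists>n. homogeneous (int n) g"
proof -
  have nat: "int (d - 2) = int d - 2" "int (d - 1) = int d - 1" using d_ge_4 by simp_all
  from assms consider (partial) r where "r < 3" "g = ext_d F $ r"
    | (omega) i r where "i \<in> {1..m}" "r < 3" "g = omega m f i $ r"
    unfolding annihilators_def by blast
  then show ?thesis
  proof cases
    case partial
    then show ?thesis using ext_d_F_homog[of r] nat(2) by (intro exI[of _ "d - 1"]) simp
  next
    case omega
    then show ?thesis using omega_homog[of i r] nat(1) by (intro exI[of _ "d - 2"]) simp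
  qed
qed

text \<open>
  Normal crossings, for an arbitrary subset of the components through the point: a dependence on it is
  extended by zero.
\<close>

lemma crossing_independent:
  assumes p: "(a, b, c) \<noteq> (0, 0, 0)"
    and T: "T \<subseteq> {1..m}" "\<And>j. j \<in> T \<Longrightarrow> eval3 (f j) a b c = 0"
    and l: "\<And>r. r < 3 \<Longrightarrow> (\<Sum>j\<in>T. l j * eval3 (ext_d (f j) $ r) a b c) = 0"
    and j: "j \<in> T"
  shows "l j = 0"
proof -
  define J where "J = {j \<in> {1..m}. eval3 (f j) a b c = 0}"
  define l' where "l' j = (if j \<in> T then l j else 0)" for j
  have TJ: "T \<subseteq> J" "finite J" using T by (auto simp: J_def)
  have "(\<Sum>j\<in>J. l' j * g j) = (\<Sum>j\<in>T. l j * g j)" for g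
    using TJ by (intro sum.mono_neutral_cong_right) (auto simp: l'_def)
  note conv = this
  have "\<forall>l. (\<Sum>j\<in>J. l j * eval3 (pdx (f j)) a b c) = 0 \<and> (\<Sum>j\<in>J. l j * eval3 (pdy (f j)) a b c) = 0 \<and>
      (\<Sum>j\<in>J. l j * eval3 (pdz (f j)) a b c) = 0 \<longrightarrow> (\<forall>j\<in>J. l j = 0)"
    using crossing p unfolding normal_crossing_def Let_def J_def by blast
  from spec[OF this, of l'] have "\<forall>j\<in>J. l' j = 0"
    using l[of 0] l[of "Suc 0"] l[of 2] unfolding conv by simp
  then have "l' j = 0" using j TJ(1) by blast
  then show ?thesis using j by (simp add: l'_def)
qed

text \<open>
  Where \<open>dF\<close> vanishes, at least two components meet, because \<open>dF = cof i df_i\<close> at a point that lies on the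
  \<open>i\<close>-th component. Exactly two meet, as the differentials of three would
  be independent and, by Euler's formula, all vanish on the point. There
  \<open>\<omega>_i = cof2 i j (df_j \<and> df_i)\<close>, which is nonzero by transversality.
\<close>

lemma no_common_zero:
  assumes p: "(a, b, c) \<noteq> (0, 0, 0)"
  shows "\<exists>g\<in>annihilators. eval3 g a b c \<noteq> 0"
proof (rule ccontr)
  define ev where "ev p = eval3 p a b c" for p
  have ev [simp]: "ev (p + q) = ev p + ev q" "ev (p - q) = ev p - ev q" "ev (p * q) = ev p * ev q" for p q
    by (simp_all add: ev_def)
  have ev_prod: "ev (\<Prod>k\<in>K. g k) = (\<Prod>k\<in>K. ev (g k))" for K and g :: "nat \<Rightarrow> poly3"
    by (simp add: ev_def)
  have ev_nat: "ev (of_nat n) = of_nat n" for n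
    by (simp add: ev_def const3_of_nat[symmetric])
  have ev_var: "ev varx = a" "ev vary = b" "ev varz = c"
    by (simp_all add: ev_def)
  assume "\<not> (\<exists>g\<in>annihilators. eval3 g a b c \<noteq> 0)"
  then have dF0: "ev (ext_d F $ r) = 0" and om0: "i \<in> {1..m} \<Longrightarrow> ev (omega m f i $ r) = 0"
    if "r < 3" for i r
    using that by (auto simp: annihilators_def ev_def)
  have indep: "l j = 0" if "T \<subseteq> {1..m}" "\<And>j. j \<in> T \<Longrightarrow> ev (f j) = 0"
    "\<And>r. r < 3 \<Longrightarrow> (\<Sum>j\<in>T. l j * ev (ext_d (f j) $ r)) = 0" "j \<in> T" for T l j
    using crossing_independent[OF p that(1)] that unfolding ev_def by blast
  have "ev (of_nat d * F) = 0"
    unfolding euler_F[symmetric] using dF0[of 0] dF0[of 1] dF0[of 2] by simp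
  then have "ev F = 0" using d_pos by (simp add: ev_nat)
  then obtain i where i: "i \<in> {1..m}" "ev (f i) = 0"
    unfolding F_def ev_prod by auto
  have "ev (cof i) = 0"
  proof (rule ccontr)
    assume nz: "ev (cof i) \<noteq> 0"
    have "ev (ext_d (f i) $ r) = 0" if "r < 3" for r
      using less_3_cases[OF that] dF0[of 0] dF0[of 1] dF0[of 2] i nz
      by (auto simp: ext_d_F_split[OF i(1)])
    then have "(1 :: complex) = 0"
      using indep[of "{i}" "\<lambda>_. 1" i] i by simp
    then show False by simp
  qed
  then have "\<exists>j\<in>{1..m} - {i}. ev (f j) = 0"
    unfolding cof_def ev_prod by simp
  then obtain j where j: "j \<in> {1..m}" "j \<noteq> i" "ev (f j) = 0" by blast
  have euler0: "a * ev (pdx (f k)) + b * ev (pdy (f k)) + c * ev (pdz (f k)) = 0"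
    if "k \<in> {1..m}" "ev (f k) = 0" for k
    using arg_cong[OF euler_f[OF that(1)], of ev] that(2) by (simp add: ev_var)
  have "ev (cof2 i j) \<noteq> 0"
  proof
    assume "ev (cof2 i j) = 0"
    then have "\<exists>k\<in>{1..m} - {i} - {j}. ev (f k) = 0"
      unfolding cof2_def ev_prod by simp
    then obtain k where k: "k \<in> {1..m}" "k \<noteq> i" "k \<noteq> j" "ev (f k) = 0" by blast
    from common_zero_imp_dependent[OF p euler0[OF i] euler0[OF j(1,3)] euler0[OF k(1,4)]]
    obtain s t u where stu: "(s, t, u) \<noteq> (0, 0, 0)"
      "s * ev (pdx (f i)) + t * ev (pdx (f j)) + u * ev (pdx (f k)) = 0"
      "s * ev (pdy (f i)) + t * ev (pdy (f j)) + u * ev (pdy (f k)) = 0"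
      "s * ev (pdz (f i)) + t * ev (pdz (f j)) + u * ev (pdz (f k)) = 0" by blast
    define l where "l = (\<lambda>n. if n = i then s else if n = j then t else u)"
    have "l n = 0" if "n \<in> {i, j, k}" for n
    proof (rule indep[of "{i, j, k}" l])
      fix r :: nat assume "r < 3"
      then show "(\<Sum>n\<in>{i, j, k}. l n * ev (ext_d (f n) $ r)) = 0"
        using stu(2-4) j(2) k(2,3) less_3_cases[OF \<open>r < 3\<close>] by (auto simp: l_def add.assoc)
    qed (use i j k that in auto)
    from this[of i] this[of j] this[of k] show False
      using stu(1) j k by (simp add: l_def)
  qed
  moreover have "cof i = f j * cof2 i j" using cof_eq[of j i] j by simp
  then have "ev (ext_d (cof i) $ r) = ev (cof2 i j) * ev (ext_d (f j) $ r)" if "r < 3" for r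
    using less_3_cases[OF that] j by (auto simp: pdx_mult pdy_mult pdz_mult)
  from this[of 0] this[of 1] this[of 2]
  have "ev (wedge (ext_d (cof i)) (ext_d (f i)) $ r)
      = ev (cof2 i j) * ev (wedge (ext_d (f j)) (ext_d (f i)) $ r)" if "r < 3" for r
    using less_3_cases[OF that] by (auto simp: algebra_simps)
  ultimately have "ev (wedge (ext_d (f j)) (ext_d (f i)) $ r) = 0" if "r < 3" for r
    using om0[OF that i(1)] that unfolding omega_eq_wedge[OF i(1)] by simp
  from this[of 0] this[of 1] this[of 2] obtain s t where st: "(s, t) \<noteq> (0, 0)"
    "s * ev (pdx (f j)) + t * ev (pdx (f i)) = 0" "s * ev (pdy (f j)) + t * ev (pdy (f i)) = 0"
    "s * ev (pdz (f j)) + t * ev (pdz (f i)) = 0"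
    using cross_zero_imp_dependent[of "ev (pdy (f j))" "ev (pdz (f i))" "ev (pdz (f j))" "ev (pdy (f i))"
        "ev (pdx (f i))" "ev (pdx (f j))"] by (simp add: algebra_simps) blast
  define l where "l = (\<lambda>n. if n = j then s else t)"
  have "l n = 0" if "n \<in> {j, i}" for n
  proof (rule indep[of "{j, i}" l])
    fix r :: nat assume "r < 3"
    then show "(\<Sum>n\<in>{j, i}. l n * ev (ext_d (f n) $ r)) = 0"
      using st(2-4) j(2) less_3_cases[OF \<open>r < 3\<close>] by (auto simp: l_def)
  qed (use i j that in auto)
  from this[of i] this[of j] show False
    using st(1) j by (simp add: l_def)
qed

lemma omega_in_image: "i \<in> {1..m} \<Longrightarrow> omega m f i \<in> mat_image A"
  using mat_imageI[OF A_carrier coord_carrier(1)[of i]] by (simp only: A_omega_coord)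

lemma omega_z_in_image: "omega_z F \<in> mat_image A"
  using mat_imageI[OF A_carrier coord_carrier(2)] by (simp only: A_omega_z_coord)

text \<open>
  Indeed \<open>dF \<and> dx\<close>, \<open>dF \<and> dy\<close> and \<open>dF \<and> dz\<close> are \<open>x \<omega>_1\<close>, \<open>y \<omega>_2\<close> and \<open>\<omega>^z\<close>.
\<close>

lemma wedge_dF_in_image:
  "wedge (ext_d F) w \<in> mat_image A"
proof -
  have *: "omega m f 1 \<in> mat_image A" "omega m f 2 \<in> mat_image A" "omega_z F \<in> mat_image A"
    using omega_in_image[of 1] omega_in_image[of 2] omega_z_in_image m_ge by auto
  let ?u = "(w $ 0 * varx) \<cdot>\<^sub>v omega m f 1 + (w $ 1 * vary) \<cdot>\<^sub>v omega m f 2 + w $ 2 \<cdot>\<^sub>v omega_z F"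
  have "wedge (ext_d F) w = ?u"
  proof (rule eq_vecI)
    show "dim_vec (wedge (ext_d F) w) = dim_vec ?u" by (simp add: omega_z_def wedge_def)
    fix r assume "r < dim_vec ?u"
    then have r: "r < 3" by (simp add: omega_z_def wedge_def)
    have "?u $ r = w $ 0 * (varx * omega m f 1 $ r) + w $ 1 * (vary * omega m f 2 $ r) + w $ 2 * omega_z F $ r"
      using r by (simp add: omega_def omega_z_def wedge_def algebra_simps)
    also have "\<dots> = wedge (ext_d F) w $ r"
      unfolding x_omega_1[OF r] y_omega_2[OF r] omega_z_def
      using less_3_cases[OF r] by (auto simp: algebra_simps)
    finally show "wedge (ext_d F) w $ r = ?u $ r" by simp
  qed
  also have "\<dots> \<in> mat_image A"
    using * by (intro mat_image_add[OF A_carrier] mat_image_smult[OF A_carrier])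
  finally show ?thesis .
qed

text \<open>
  The expansion of \<open>dF \<times> (v \<times> e_r)\<close> is \<open>F_r v\<close>, since \<open>dF \<cdot> v = 0\<close>.
\<close>

lemma partial_annihilates:
  assumes v: "v \<in> jacobian_syzygies F" and r: "r < 3"
  shows "ext_d F $ r \<cdot>\<^sub>v v \<in> mat_image A"
proof -
  have car: "v \<in> carrier_vec 3" and eq: "v $ 0 * pdx F + v $ 1 * pdy F + v $ 2 * pdz F = 0"
    using v by (auto simp: jacobian_syzygies_def)
  have "ext_d F $ r \<cdot>\<^sub>v v = wedge (ext_d F) (wedge v (unit_vec 3 r))"
    using less_3_cases[OF r] car eq
    by (intro vec3_eqI) (auto simp: algebra_simps add_eq_0_iff)
  then show ?thesis using wedge_dF_in_image by simp
qed

text \<open>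
  The product rule gives \<open>f_j (dG_j \<cdot> t) + G_j (df_j \<cdot> t) = 0\<close> for \<open>G_j = F / f_j\<close>, and \<open>f_j\<close> is prime
  and does not divide \<open>G_j\<close>.
\<close>

lemma syzygy_logarithmic:
  assumes eq: "t0 * pdx F + t1 * pdy F + t2 * pdz F = 0" and j: "j \<in> {1..m}"
  obtains h where "t0 * pdx (f j) + t1 * pdy (f j) + t2 * pdz (f j) = f j * h"
    and "t0 * pdx (cof j) + t1 * pdy (cof j) + t2 * pdz (cof j) = - (cof j * h)"
proof -
  define p where "p = t0 * pdx (f j) + t1 * pdy (f j) + t2 * pdz (f j)"
  define q where "q = t0 * pdx (cof j) + t1 * pdy (cof j) + t2 * pdz (cof j)"
  have 0: "f j * q + cof j * p = 0"
    using eq unfolding ext_d_F_split[OF j] p_def q_def by (simp add: algebra_simps)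
  then have "cof j * p = f j * (- q)" by (simp add: add_eq_0_iff)
  then have "f j dvd cof j * p" by simp
  then have "f j dvd p"
    using f_prime[OF j] not_dvd_cof[OF j] by (simp add: prime_elem_dvd_mult_iff)
  then obtain h where h: "p = f j * h" ..
  have "f j * (q + cof j * h) = 0" using 0 unfolding h by (simp add: algebra_simps)
  then have "q = - (cof j * h)" using f_nz[OF j] by (simp add: eq_neg_iff_add_eq_0)
  then show thesis using that h unfolding p_def q_def by blast
qed

text \<open>
  Since \<open>v\<close> is logarithmic, \<open>v \<times> \<omega>_i = h dF\<close>. The cross product of \<open>e_r\<close> with this equation expresses
  \<open>(\<omega>_i)_r v - v_r \<omega>_i\<close> as a multiple of \<open>e_r \<times> dF\<close>, and both \<open>\<omega>_i\<close> and the latter are in the image.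
\<close>

lemma omega_annihilates:
  assumes v: "v \<in> jacobian_syzygies F" and i: "i \<in> {1..m}" and r: "r < 3"
  shows "omega m f i $ r \<cdot>\<^sub>v v \<in> mat_image A"
proof -
  have car: "v \<in> carrier_vec 3" and eq: "v $ 0 * pdx F + v $ 1 * pdy F + v $ 2 * pdz F = 0"
    using v by (auto simp: jacobian_syzygies_def)
  obtain h where h: "v $ 0 * pdx (f i) + v $ 1 * pdy (f i) + v $ 2 * pdz (f i) = f i * h"
    "v $ 0 * pdx (cof i) + v $ 1 * pdy (cof i) + v $ 2 * pdz (cof i) = - (cof i * h)"
    using syzygy_logarithmic[OF eq i] by blast
  have cross: "wedge v (omega m f i) $ s = h * ext_d F $ s" if s: "s < 3" for s
  proof -
    have "wedge v (omega m f i) $ s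
        = ext_d (cof i) $ s * (v $ 0 * pdx (f i) + v $ 1 * pdy (f i) + v $ 2 * pdz (f i))
        - ext_d (f i) $ s * (v $ 0 * pdx (cof i) + v $ 1 * pdy (cof i) + v $ 2 * pdz (cof i))"
      unfolding omega_eq_wedge[OF i] using less_3_cases[OF s] by (auto simp: algebra_simps)
    also have "\<dots> = h * ext_d F $ s"
      unfolding h using less_3_cases[OF s] ext_d_F_split[OF i] by (auto simp: algebra_simps)
    finally show ?thesis .
  qed
  have "omega m f i $ r \<cdot>\<^sub>v v = v $ r \<cdot>\<^sub>v omega m f i + wedge (ext_d F) ((- h) \<cdot>\<^sub>v unit_vec 3 r)"
    using cross[of 0] cross[of 1] cross[of 2] less_3_cases[OF r] car omega_carrier[of i]
    by (intro vec3_eqI) (auto simp: algebra_simps)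
  also have "\<dots> \<in> mat_image A"
    by (intro mat_image_add[OF A_carrier] mat_image_smult[OF A_carrier] omega_in_image[OF i] wedge_dF_in_image)
  finally show ?thesis .
qed

lemma image_A: "mat_image A = jacobian_syzygies F"
proof
  show "mat_image A \<subseteq> jacobian_syzygies F"
  proof
    fix w assume "w \<in> mat_image A"
    then obtain v where v: "v \<in> carrier_vec m" "w = A *\<^sub>v v" by (rule mat_imageE[OF _ A_carrier])
    have om: "omega m f i $ 0 * pdx F + omega m f i $ Suc 0 * pdy F + omega m f i $ 2 * pdz F = 0"
      if "i \<in> {1..m}" for i
      unfolding omega_eq_wedge[OF that] ext_d_F_split[OF that] by (simp add: algebra_simps)
    have "w $ 0 * pdx F + w $ 1 * pdy F + w $ 2 * pdz F
      = (\<Sum>i=1..m-1. v $ (i - 1) * (omega m f i $ 0 * pdx F + omega m f i $ Suc 0 * pdy F + omega m f i $ 2 * pdz F))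
        + v $ (m - 1) * (omega_z F $ 0 * pdx F + omega_z F $ Suc 0 * pdy F + omega_z F $ 2 * pdz F)"
      unfolding v(2) by (simp add: A_mult_index[OF v(1)] sum_distrib_left sum.distrib algebra_simps)
    also have "\<dots> = 0"
    proof -
      have "(\<Sum>i=1..m-1. v $ (i - 1) * (omega m f i $ 0 * pdx F + omega m f i $ Suc 0 * pdy F + omega m f i $ 2 * pdz F)) = 0"
        by (rule sum.neutral) (use om in auto)
      moreover have "omega_z F $ 0 * pdx F + omega_z F $ Suc 0 * pdy F + omega_z F $ 2 * pdz F = 0"
        by (simp add: omega_z_def)
      ultimately show ?thesis by (simp only: mult_zero_right add_0)
    qed
    finally show "w \<in> jacobian_syzygies F"
      using v A_carrier by (simp add: jacobian_syzygies_def)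
  qed
  show "jacobian_syzygies F \<subseteq> mat_image A"
  proof
    fix v assume v: "v \<in> jacobian_syzygies F"
    then have car: "v \<in> carrier_vec 3" by (simp add: jacobian_syzygies_def)
    define I where "I = {p. p \<cdot>\<^sub>v v \<in> mat_image A}"
    have I: "ideal3 I"
      unfolding ideal3_def
    proof (intro conjI ballI allI)
      have "0 \<cdot>\<^sub>v v = 0\<^sub>v 3" using car by (intro eq_vecI) auto
      then show "0 \<in> I" using mat_image_0[OF A_carrier] by (simp add: I_def)
    next
      fix p q assume "p \<in> I" "q \<in> I"
      then show "p + q \<in> I" using mat_image_add[OF A_carrier] by (simp add: I_def add_smult_distrib_vec)
    next
      fix p q assume "q \<in> I"
      then show "p * q \<in> I" using mat_image_smult[OF A_carrier] by (simp add: I_def smult_smult_assoc[symmetric])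
    qed
    have sub: "annihilators \<subseteq> I"
      using partial_annihilates[OF v] omega_annihilates[OF v] by (auto simp: annihilators_def I_def)
    have homG: "\<exists>n. homogeneous (int n) g" if "g \<in> annihilators" for g
      using homogeneous_annihilator[OF that] .
    have "\<exists>N. u ^ N \<in> I" if "u \<in> {varx, vary, varz}" for u
      by (rule homogeneous_nullstellensatz[OF I sub homG no_common_zero that])
    from this[of varx] this[of vary] this[of varz]
    obtain N1 N2 N3 where N: "varx ^ N1 \<in> I" "vary ^ N2 \<in> I" "varz ^ N3 \<in> I"
      by auto
    have "u ^ (n + k) \<in> I" if "u ^ n \<in> I" for u n k
      using ideal3D(4)[OF I that] by (simp add: power_add)
    from this[OF N(1), of "N2 + N3"] this[OF N(2), of "N1 + N3"] this[OF N(3), of "N1 + N2"]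
    have "varx ^ (N1 + N2 + N3) \<in> I" "vary ^ (N1 + N2 + N3) \<in> I" "varz ^ (N1 + N2 + N3) \<in> I"
      by (simp_all add: ac_simps)
    then show "v \<in> mat_image A"
      using mat_image_saturated[OF A_carrier B_carrier kernel_A kernel_B car] by (auto simp: I_def)
  qed
qed

section \<open>The resolutions\<close>

text \<open>
  The shift \<open>s\<close> is zero in the resolution of the syzygy module and \<open>d - 1\<close> in the one of the Jacobian algebra.
\<close>

lemma A_graded:
  "graded_map (replicate (m - 1) (int d - 2 + s) @ [int d - 1 + s]) [s, s, s] A"
  unfolding graded_map_def
proof (intro conjI allI impI)
  show "A \<in> carrier_mat (length [s, s, s]) (length (replicate (m - 1) (int d - 2 + s) @ [int d - 1 + s]))"
    using A_carrier m_ge by (simp add: numeral_3_eq_3)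
  fix r k assume "r < length [s, s, s]" "k < length (replicate (m - 1) (int d - 2 + s) @ [int d - 1 + s])"
  then have r: "r < 3" and k: "k < m" using m_ge by auto
  have entry: "A $$ (r, k) = col A k $ r" using r k A_carrier by simp
  have s: "[s, s, s] ! r = s" using less_3_cases[OF r] by auto
  show "homogeneous ((replicate (m - 1) (int d - 2 + s) @ [int d - 1 + s]) ! k - [s, s, s] ! r) (A $$ (r, k))"
  proof (cases "k < m - 1")
    case True
    then show ?thesis using omega_homog[of "Suc k" r] r unfolding entry s
      by (simp add: col_A nth_append)
  next
    case False
    then have "k = m - 1" using k by simp
    then show ?thesis using omega_z_homog[OF r] col_A(2) unfolding entry s
      by (simp add: nth_append)
  qed
qed

lemma rho_homog:
  assumes j: "j \<in> {3..m}" and k: "k < m"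
  shows "homogeneous (if k = m - 1 then int (e j) - 1 else int (e j)) (rho m f j $ k)"
proof (cases "k = m - 1")
  case True
  moreover have "m - Suc 0 \<noteq> Suc 0" using m_ge by simp
  ultimately show ?thesis
    using j homogeneous_minus[OF homogeneous_pd(3)[OF homog[of j]]] m_ge by (auto simp: rho_index)
next
  case False
  have "homogeneous (int (e j)) (varx * pdx (f j))" "homogeneous (int (e j)) (vary * pdy (f j))"
    using homogeneous_mult[OF homogeneous_var(1) homogeneous_pd(1)[OF homog[of j]]]
      homogeneous_mult[OF homogeneous_var(2) homogeneous_pd(2)[OF homog[of j]]] j by simp_all
  then show ?thesis
    using j k False homog[of j] unfolding rho_index[OF j k]
    by (auto intro!: homogeneous_diff homogeneous_minus)
qed

lemma B_graded:
  "graded_map (map (\<lambda>j. int d - 2 + int (e j) + s) [3..<Suc m])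
     (replicate (m - 1) (int d - 2 + s) @ [int d - 1 + s]) B"
  unfolding graded_map_def
proof (intro conjI allI impI)
  let ?b = "replicate (m - 1) (int d - 2 + s) @ [int d - 1 + s]"
  let ?c = "map (\<lambda>j. int d - 2 + int (e j) + s) [3..<Suc m]"
  show "B \<in> carrier_mat (length ?b) (length ?c)"
    using B_carrier m_ge by (simp del: upt_Suc)
  fix k l assume "k < length ?b" "l < length ?c"
  then have k: "k < m" and l: "l < m - 2" using m_ge by (auto simp del: upt_Suc)
  have entry: "B $$ (k, l) = col B l $ k" using k l B_carrier by simp
  have c: "?c ! l = int d - 2 + int (e (l + 3)) + s"
    using l by (simp add: add.commute del: upt_Suc)
  have b: "?b ! k = (if k = m - 1 then int d - 1 + s else int d - 2 + s)"
    using k by (auto simp: nth_append)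
  show "homogeneous (?c ! l - ?b ! k) (B $$ (k, l))"
    using rho_homog[of "l + 3" k] k l unfolding entry c b col_B[OF l] by (auto split: if_splits)
qed

lemma minimal_A: "elements_mat A \<subseteq> irrelevant_ideal"
proof
  fix p assume "p \<in> elements_mat A"
  then obtain r k where rk: "r < 3" "k < m" "p = A $$ (r, k)" using A_carrier by auto
  show "p \<in> irrelevant_ideal"
  proof (cases "k < m - 1")
    case True
    then have "p = omega m f (Suc k) $ r" using rk A_carrier col_A(1)[of k] by (metis carrier_matD index_col)
    then have "homogeneous (int d - 2) p"
      using omega_homog[of "Suc k" r] rk True by simp
    then show ?thesis using d_ge_4 by (intro homogeneous_irrelevant) auto
  next
    case False
    then have "k = m - 1" using rk by simp
    then have "p = omega_z F $ r" using rk A_carrier col_A(2) by (metis carrier_matD index_col)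
    then have "homogeneous (int d - 1) p"
      using omega_z_homog[of r] rk by simp
    then show ?thesis using d_ge_4 by (intro homogeneous_irrelevant) auto
  qed
qed

lemma minimal_B: "elements_mat B \<subseteq> irrelevant_ideal"
proof
  fix p assume "p \<in> elements_mat B"
  then obtain k l where kl: "k < m" "l < m - 2" "p = B $$ (k, l)" using B_carrier by auto
  then have "p = rho m f (l + 3) $ k" using B_carrier col_B[of l] by (metis carrier_matD index_col)
  moreover have "l + 3 \<in> {3..m}" using kl(2) by simp
  ultimately show "p \<in> irrelevant_ideal"
    using homogeneous_irrelevant[OF rho_homog[of "l + 3" k]] e_ge_2[of "l + 3"] kl(1)
    by (auto split: if_splits)
qed

lemma syzygies_resolution:
  "minimal_graded_free_resolution [0, 0, 0] (jacobian_syzygies F) {0\<^sub>v 3}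
     [replicate (m - 1) (int d - 2) @ [int d - 1], map (\<lambda>j. int d - 2 + int (e j)) [3..<Suc m]] A [B]"
proof -
  let ?b = "replicate (m - 1) (int d - 2) @ [int d - 1]"
  let ?c = "map (\<lambda>j. int d - 2 + int (e j)) [3..<Suc m]"
  have len: "length ?b = m" "length ?c = m - 2" using m_ge by (simp_all del: upt_Suc)
  have "{u + k |u k. u \<in> mat_image A \<and> k \<in> {0\<^sub>v 3}} = mat_image A"
    using mat_image_carrier[OF A_carrier] by force
  moreover have "{v \<in> carrier_vec m. A *\<^sub>v v \<in> {0\<^sub>v 3}} = mat_image B"
    unfolding kernel_A[symmetric] mat_kernel[OF A_carrier] by simp
  ultimately show ?thesis
    using A_graded[of 0] B_graded[of 0] kernel_B image_A minimal_B len
    unfolding minimal_graded_free_resolution_def incoming_image_def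
    by (simp del: upt_Suc)
qed

definition gradient_row :: "poly3 mat" where
  "gradient_row = mat 1 3 (\<lambda>(i, j). ext_d F $ j)"

lemma gradient_row_carrier: "gradient_row \<in> carrier_mat 1 3"
  by (simp add: gradient_row_def)

lemma gradient_row_mult:
  assumes "v \<in> carrier_vec 3"
  shows "(gradient_row *\<^sub>v v) $ 0 = v $ 0 * pdx F + v $ 1 * pdy F + v $ 2 * pdz F"
proof -
  have "{0..<3} = {0, 1, 2::nat}" by auto
  then show ?thesis
    using assms by (simp add: gradient_row_def scalar_prod_def mult.commute add.assoc)
qed

lemma vec1_eq_iff: "v \<in> carrier_vec 1 \<Longrightarrow> w \<in> carrier_vec 1 \<Longrightarrow> v = w \<longleftrightarrow> v $ 0 = w $ 0"
  by (auto intro!: eq_vecI)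

lemma gradient_row_image: "mat_image gradient_row = {v \<in> carrier_vec 1. v $ 0 \<in> jacobian_ideal F}"
proof
  show "mat_image gradient_row \<subseteq> {v \<in> carrier_vec 1. v $ 0 \<in> jacobian_ideal F}"
  proof
    fix w assume "w \<in> mat_image gradient_row"
    then obtain v where v: "v \<in> carrier_vec 3" "w = gradient_row *\<^sub>v v"
      by (rule mat_imageE[OF _ gradient_row_carrier])
    have "w \<in> carrier_vec 1" using v gradient_row_carrier by simp
    moreover have "w $ 0 \<in> jacobian_ideal F"
      unfolding v(2) gradient_row_mult[OF v(1)] jacobian_ideal_def by blast
    ultimately show "w \<in> {v \<in> carrier_vec 1. v $ 0 \<in> jacobian_ideal F}" by simp
  qed
  show "{v \<in> carrier_vec 1. v $ 0 \<in> jacobian_ideal F} \<subseteq> mat_image gradient_row"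
  proof clarify
    fix w assume w: "w \<in> carrier_vec 1" "w $ 0 \<in> jacobian_ideal F"
    then obtain a b c where abc: "w $ 0 = a * pdx F + b * pdy F + c * pdz F"
      by (auto simp: jacobian_ideal_def)
    define v where "v = vec 3 (\<lambda>r. if r = 0 then a else if r = 1 then b else c)"
    have v: "v \<in> carrier_vec 3" by (simp add: v_def)
    have "w = gradient_row *\<^sub>v v"
      using w v gradient_row_carrier gradient_row_mult[OF v] abc
      by (subst vec1_eq_iff) (auto simp: v_def)
    then show "w \<in> mat_image gradient_row" using mat_imageI[OF gradient_row_carrier v] by simp
  qed
qed

text \<open>
  This is where the two resolutions are spliced.
\<close>

lemma gradient_row_kernel: "mat_kernel gradient_row = mat_image A"
  unfolding image_A mat_kernel[OF gradient_row_carrier] jacobian_syzygies_def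
  using gradient_row_mult gradient_row_carrier
  by (auto simp: vec1_eq_iff[of "gradient_row *\<^sub>v _"])

lemma gradient_row_graded: "graded_map (replicate 3 (int d - 1)) [0] gradient_row"
  unfolding graded_map_def using gradient_row_carrier ext_d_F_homog by (auto simp: gradient_row_def)

lemma gradient_row_minimal: "elements_mat gradient_row \<subseteq> irrelevant_ideal"
proof
  fix p assume "p \<in> elements_mat gradient_row"
  then obtain r where "r < 3" "p = ext_d F $ r" by (auto simp: gradient_row_def)
  then show "p \<in> irrelevant_ideal"
    using homogeneous_irrelevant[OF ext_d_F_homog] d_ge_4 by auto
qed

lemma jacobian_algebra_resolution:
  "minimal_graded_free_resolution [0] (carrier_vec 1) {v \<in> carrier_vec 1. v $ 0 \<in> jacobian_ideal F}
     [[0], replicate 3 (int d - 1), replicate (m - 1) (2 * int d - 3) @ [2 * int d - 2],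
      map (\<lambda>j. 2 * int d - 3 + int (e j)) [3..<Suc m]]
     (1\<^sub>m 1) [gradient_row, A, B]"
proof -
  let ?a = "replicate 3 (int d - 1)"
  let ?b = "replicate (m - 1) (2 * int d - 3) @ [2 * int d - 2]"
  let ?c = "map (\<lambda>j. 2 * int d - 3 + int (e j)) [3..<Suc m]"
  let ?K = "{v \<in> carrier_vec 1. v $ 0 \<in> jacobian_ideal F}"
  have len: "length ?b = m" "length ?c = m - 2" using m_ge by (simp_all del: upt_Suc)
  have a: "?a = [int d - 1, int d - 1, int d - 1]" by (simp add: numeral_3_eq_3)
  have shift: "int d - 2 + (int d - 1) = 2 * int d - 3" "int d - 1 + (int d - 1) = 2 * int d - 2"
    "int d - 2 + int n + (int d - 1) = 2 * int d - 3 + int n" for n by simp_all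
  have gA: "graded_map ?b ?a A"
    using A_graded[of "int d - 1"] unfolding a shift .
  have gB: "graded_map ?c ?b B"
    using B_graded[of "int d - 1"] unfolding shift .
  have E: "graded_map [0] [0] (1\<^sub>m 1)"
    using homogeneous_1 by (simp add: graded_map_def)
  have image_1: "mat_image (1\<^sub>m 1) = carrier_vec 1"
    by (force simp: mat_image_def)
  have K0: "0\<^sub>v 1 \<in> ?K"
    unfolding gradient_row_image[symmetric] by (rule mat_image_0[OF gradient_row_carrier])
  have N: "carrier_vec 1 = {u + k |u k. u \<in> mat_image (1\<^sub>m 1) \<and> k \<in> ?K}"
    unfolding image_1
  proof (intro equalityI subsetI)
    fix v :: "poly3 vec" assume v: "v \<in> carrier_vec 1"
    then have "v = v + 0\<^sub>v 1" by simp
    then show "v \<in> {u + k |u k. u \<in> carrier_vec 1 \<and> k \<in> ?K}" using v K0 by blast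
  next
    fix v assume "v \<in> {u + k |u k. u \<in> carrier_vec 1 \<and> k \<in> ?K}"
    then show "v \<in> carrier_vec 1" by auto
  qed
  have K: "{v \<in> carrier_vec 1. 1\<^sub>m 1 *\<^sub>v v \<in> ?K} = mat_image gradient_row"
    unfolding gradient_row_image by auto
  let ?bs = "[[0], ?a, ?b, ?c]"
  let ?As = "[gradient_row, A, B]"
  have cases3: "i = 0 \<or> i = 1 \<or> i = 2" if "i < length ?As" for i :: nat
    using that by auto
  show ?thesis
    unfolding minimal_graded_free_resolution_def
  proof (intro conjI allI impI)
    show "graded_map (?bs ! 0) [0] (1\<^sub>m 1)" using E by simp
    show "graded_map (?bs ! Suc i) (?bs ! i) (?As ! i)" if "i < length ?As" for i
      using cases3[OF that] gA gB gradient_row_graded by (auto simp del: upt_Suc replicate.simps)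
    show "mat_kernel (?As ! i) = incoming_image ?bs ?As (Suc i)" if "i < length ?As" for i
      using cases3[OF that] gradient_row_kernel kernel_A kernel_B len
      by (auto simp: incoming_image_def simp del: upt_Suc)
    show "elements_mat (?As ! i) \<subseteq> irrelevant_ideal" if "i < length ?As" for i
      using cases3[OF that] gradient_row_minimal minimal_A minimal_B by auto
    show "{v \<in> carrier_vec (length (?bs ! 0)). 1\<^sub>m 1 *\<^sub>v v \<in> ?K} = incoming_image ?bs ?As 0"
      using K by (simp add: incoming_image_def)
  qed (use N in auto)
qed

end

theorem theorem1p5:
  fixes m :: nat and f :: "nat \<Rightarrow> poly3" and e :: "nat \<Rightarrow> nat" and F :: poly3 and d :: int
  assumes "m \<ge> 4"
    and "\<And>j. j \<in> {1..m} \<Longrightarrow> irreducible (f j)"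
    and "\<And>j. j \<in> {1..m} \<Longrightarrow> homogeneous (int (e j)) (f j)"
    and "\<And>j. j \<in> {1..m} \<Longrightarrow> smooth_curve (f j)"
    and "\<And>i j. i \<in> {1..m} \<Longrightarrow> j \<in> {1..m} \<Longrightarrow> i \<noteq> j \<Longrightarrow> \<not> f i dvd f j"
    and "normal_crossing {1..m} f"
    and "card {j \<in> {1..m}. e j = 1} = 2"
    and "f 1 = varx"
    and "f 2 = vary"
    and "F = (\<Prod>j=1..m. f j)"
    and "d = (\<Sum>j=1..m. int (e j))"
  shows "syzygies_resolution_shape F
           [replicate (m - 1) (d - 2) @ [d - 1],
            map (\<lambda>j. d - 2 + int (e j)) [3..<Suc m]] \<and>
         jacobian_algebra_resolution_shape F
           [[0],
            replicate 3 (d - 1),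
            replicate (m - 1) (2 * d - 3) @ [2 * d - 2],
            map (\<lambda>j. 2 * d - 3 + int (e j)) [3..<Suc m]] \<and>
         minimal_graded_free_resolution [0, 0, 0] (jacobian_syzygies F) {0\<^sub>v 3}
           [replicate (m - 1) (d - 2) @ [d - 1],
            map (\<lambda>j. d - 2 + int (e j)) [3..<Suc m]]
           (omega_matrix m f) [rho_matrix m f] \<and>
         (\<forall>j\<in>{3..m}.
           f j \<cdot>\<^sub>v omega_subst m f j -
             ((varx * pdx (f j)) \<cdot>\<^sub>v omega m f 1 + (vary * pdy (f j)) \<cdot>\<^sub>v omega m f 2 +
              pdz (f j) \<cdot>\<^sub>v omega_z F) = 0\<^sub>v 3)"
proof -
  have lines: "e 1 = 1" "e 2 = 1"
    using homogeneous_line_degree(1)[OF assms(3)[of 1, unfolded assms(8)]]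
      homogeneous_line_degree(2)[OF assms(3)[of 2, unfolded assms(9)]] assms(1) by simp_all
  \<comment> \<open>The lines \<open>x\<close> and \<open>y\<close> already account for the two components of degree one.\<close>
  have "{1, 2} = {j \<in> {1..m}. e j = 1}"
    by (rule card_subset_eq) (use assms(1,7) lines in auto)
  then have "e j \<noteq> 1" if "j \<in> {3..m}" for j
    using that by (auto simp: set_eq_iff dest!: spec[of _ j])
  moreover have "0 < e j" if "j \<in> {1..m}" for j
    using irreducible_homogeneous_pos assms(2,3) that by blast
  ultimately have e: "2 \<le> e j" if "j \<in> {3..m}" for j
    using that by (force simp: numeral_2_eq_2 Suc_le_eq intro: le_neq_implies_less)
  interpret C: two_line_arrangement m f e
    by unfold_locales (use assms e in auto)
  have F: "F = C.F" and d: "d = int C.d"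
    by (simp_all add: assms(10,11) C.F_def C.d_def)
  have "f j \<cdot>\<^sub>v omega_subst m f j - ((varx * pdx (f j)) \<cdot>\<^sub>v omega m f 1 + (vary * pdy (f j)) \<cdot>\<^sub>v omega m f 2 +
              pdz (f j) \<cdot>\<^sub>v omega_z F) = 0\<^sub>v 3" if "j \<in> {3..m}" for j
    using C.rho_relation[of j] C.omega_subst_eq[of j] that by (simp add: F)
  then show ?thesis
    using C.syzygies_resolution C.jacobian_algebra_resolution
    unfolding syzygies_resolution_shape_def jacobian_algebra_resolution_shape_def
      minimal_resolution_shape_def F d by blast
qed

end
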